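(* Let $\theta\in\mathbb{R}$. A function $\phi:\mathbb{C}_{\theta}\to\mathbb{C}_{\frac12}$ defines a composition operator $C_\phi:\mathcal{H}_{+}\to\mathcal{D}$ if and only if $\phi$ is analytic on some half-plane $\mathbb{C}_{\mu}$ and there it has the form $$\phi(s)=c_0 s+\varphi(s),\qquad\text{where } c_0\in\mathbb{N}\cup\{0\}\text{ and }\varphi\in\mathcal{D}.$$
   Context: For $\sigma\in\mathbb{R}$, $\mathbb{C}_\sigma=\{s\in\mathbb{C}:\operatorname{Re}s>\sigma\}$. $\mathcal{D}$ is the space of Dirichlet series $\sum a_nn^{-s}$ that converge at some point of $\mathbb{C}$ (hence define a holomorphic function on some half-plane). $\mathcal{H}_{+}$ is the space of Dirichlet series $D=\sum a_nn^{-s}$ with $\sum_n|a_n|^2n^{-2\sigma}<\infty$ for every $\sigma>0$; each such series converges absolutely on $\mathbb{C}_{\frac12}$, so $D\circ\phi$ makes sense on $\mathbb{C}_\theta$. "$\phi$ defines a composition operator $C_\phi:\mathcal{H}_+\to\mathcal{D}$" means that for every $D\in\mathcal{H}_+$ the function $C_\phi(D)=D\circ\phi$ is represented, on some half-plane, by a Dirichlet series in $\mathcal{D}$. *)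

theory Defs
  imports "HOL-Analysis.Analysis"
begin

definition half_plane :: "real \<Rightarrow> complex set" where
  "half_plane \<sigma> = {s. Re s > \<sigma>}"

text \<open>
  A Dirichlet series is represented by its coefficient sequence \<open>a\<close>. Its terms are the
  \<open>a n * n powr (-s)\<close> with \<open>n \<ge> 1\<close>, so the sums below are shifted by one and
  the value \<open>a 0\<close> is irrelevant throughout.
\<close>

definition dirichlet_term :: "(nat \<Rightarrow> complex) \<Rightarrow> complex \<Rightarrow> nat \<Rightarrow> complex" where
  "dirichlet_term a s n = a (Suc n) * of_nat (Suc n) powr (- s)"

definition dirichlet_sum :: "(nat \<Rightarrow> complex) \<Rightarrow> complex \<Rightarrow> complex" where
  "dirichlet_sum a s = (\<Sum>n. dirichlet_term a s n)"

definition Dirichlet_space :: "(nat \<Rightarrow> complex) set" where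
  "Dirichlet_space = {a. \<exists>s. summable (dirichlet_term a s)}"

definition H_plus :: "(nat \<Rightarrow> complex) set" where
  "H_plus = {a. \<forall>\<sigma>>0. summable (\<lambda>n. (cmod (a (Suc n)))\<^sup>2 * real (Suc n) powr (- 2 * \<sigma>))}"

definition dirichlet_represents :: "(nat \<Rightarrow> complex) \<Rightarrow> complex set \<Rightarrow> (complex \<Rightarrow> complex) \<Rightarrow> bool" where
  "dirichlet_represents b U f \<longleftrightarrow> (\<forall>s\<in>U. dirichlet_term b s sums f s)"

text \<open>
  The symbol \<open>\<phi>\<close> is a function on \<open>half_plane \<theta>\<close>; its values elsewhere are
  arbitrary, whence \<open>\<nu> \<ge> \<theta>\<close>. The half-plane on which the composition is represented
  may depend on the series.
\<close>

definition defines_composition_operator :: "real \<Rightarrow> (complex \<Rightarrow> complex) \<Rightarrow> bool" where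
  "defines_composition_operator \<theta> \<phi> \<longleftrightarrow>
     (\<forall>a\<in>H_plus. \<exists>b\<in>Dirichlet_space. \<exists>\<nu>\<ge>\<theta>.
        dirichlet_represents b (half_plane \<nu>) (dirichlet_sum a \<circ> \<phi>))"

end

(*
  Everything takes place in the algebras of absolutely convergent general Dirichlet series
  sum c_i exp(-l_i s) with frequencies l_i in a fixed additive semigroup; they are closed under
  products, exponentials and, for small norm, s |-> Ln (1 + f s).

  Sufficiency: n^(-phi(s)) = n^(-c0 s) n^(-c_1) exp(-v(s) log n), where v is psi without its constant
  term c_1, has norm at most n^(eps - c0 sigma - Re c_1), and summing over n against coefficients from
  H_+ is possible once that exponent is below -1/2. For c0 = 0 this needs Re c_1 > 1/2, which follows
  from phi mapping into Re s > 1/2.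

  Necessity: applied to D = n^(-s), the hypothesis makes n^(-phi) a Dirichlet series, with leading term
  z m_n^(-s), say. Then Re phi(x) / x tends to log m_n / log n, so this quotient is a constant c0, and
  n^c0 = m_n is an integer for all n, which forces c0 to be a natural number. Taking logarithms for
  n = 2, 3 determines phi(s) - c0 s up to integers k_n(s) in 2 pi i k_n(s) / log n. These integers are
  constant, because the two resulting expressions differ by a continuous function with countable
  range and log 2 / log 3 is irrational. So phi(s) - c0 s is a general Dirichlet series whose
  frequencies are logarithms of fractions with denominator a power of 2, and also one with powers
  of 3. By uniqueness of mean values only logarithms of integers occur.
*)
theory Submission
  imports Defs "HOL-Complex_Analysis.Complex_Analysis"
begin

subsection \<open>Absolutely convergent general Dirichlet series\<close>

text \<open>
  The frequencies may repeat, so that sums and products of such series need no regrouping. The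
  number \<open>N\<close> bounds the sum of the absolute values on the line \<open>Re s = \<sigma>\<close>; the values of \<open>f\<close>
  to the left of it are arbitrary.
\<close>
definition gds :: "real set \<Rightarrow> real \<Rightarrow> real \<Rightarrow> (complex \<Rightarrow> complex) \<Rightarrow> bool" where
  "gds L \<sigma> N f \<longleftrightarrow> (\<exists>(c::nat \<Rightarrow> complex) l.
     (\<forall>i. l i \<in> L \<and> 0 \<le> l i) \<and>
     (\<exists>M\<le>N. ((\<lambda>i. cmod (c i) * exp (- \<sigma> * l i)) has_sum M) UNIV) \<and>
     (\<forall>s. \<sigma> \<le> Re s \<longrightarrow> ((\<lambda>i. c i * exp (- s * of_real (l i))) has_sum f s) UNIV))"

lemma exp_frequency_mono:
  fixes l :: real
  assumes "0 \<le> l" "\<sigma> \<le> \<tau>"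
  shows "exp (- \<tau> * l) \<le> exp (- \<sigma> * l)"
  using mult_right_mono[OF assms(2,1)] by simp

lemma norm_gds_term: "cmod (c * exp (- s * of_real l)) = cmod c * exp (- Re s * l)"
  by (simp add: norm_mult)

lemma abs_summable_gds_terms:
  assumes "(\<lambda>i. cmod (c i) * exp (- \<sigma> * l i)) summable_on I" "\<And>i. i \<in> I \<Longrightarrow> 0 \<le> l i" "\<sigma> \<le> Re s"
  shows "(\<lambda>i. cmod (c i * exp (- s * of_real (l i)))) summable_on I"
  unfolding norm_gds_term
  by (rule summable_on_comparison_test[OF assms(1)])
    (use assms(2,3) exp_frequency_mono in \<open>auto intro!: mult_left_mono\<close>)

lemma summable_gds_terms:
  assumes "(\<lambda>i. cmod (c i) * exp (- \<sigma> * l i)) summable_on I" "\<And>i. i \<in> I \<Longrightarrow> 0 \<le> l i" "\<sigma> \<le> Re s"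
  shows "(\<lambda>i. c i * exp (- s * of_real (l i))) summable_on I"
  by (rule abs_summable_summable[OF abs_summable_gds_terms[OF assms]])

text \<open>Products and double sums are naturally indexed by pairs, whereas \<open>gds\<close> is
  indexed by \<open>nat\<close>. An enumeration of \<open>I\<close> transports the series; the
  remaining naturals get coefficient 0 at frequency 0, and for them 0 has to lie in
  \<open>L\<close>.\<close>

lemma gdsI:
  fixes I :: "'i set"
  assumes "countable I" "0 \<in> L" and l: "\<And>i. i \<in> I \<Longrightarrow> l i \<in> L \<and> 0 \<le> l i"
    and M: "((\<lambda>i. cmod (c i) * exp (- \<sigma> * l i)) has_sum M) I" "M \<le> N"
    and f: "\<And>s. \<sigma> \<le> Re s \<Longrightarrow> f s = (\<Sum>\<^sub>\<infinity>i\<in>I. c i * exp (- s * of_real (l i)))"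
  shows "gds L \<sigma> N f"
proof -
  let ?e = "to_nat_on I" and ?d = "from_nat_into I"
  define c' where "c' n = (if n \<in> ?e ` I then c (?d n) else 0)" for n
  define l' where "l' n = (if n \<in> ?e ` I then l (?d n) else 0)" for n
  have bij: "bij_betw ?e I (?e ` I)"
    using inj_on_to_nat_on[OF \<open>countable I\<close>] by (simp add: inj_on_imp_bij_betw)
  have *: "((\<lambda>i. g (c' i) (l' i)) has_sum S) UNIV" if "((\<lambda>i. g (c i) (l i)) has_sum S) I"
    and "g 0 0 = 0" for g :: "complex \<Rightarrow> real \<Rightarrow> 'x::{topological_comm_monoid_add,t2_space}" and S
  proof -
    have "((\<lambda>n. g (c' n) (l' n)) has_sum S) (?e ` I)"
      unfolding has_sum_reindex_bij_betw[OF bij, symmetric]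
      using that(1) by (rule has_sum_cong[THEN iffD1, rotated])
        (use \<open>countable I\<close> in \<open>simp add: c'_def l'_def\<close>)
    then show ?thesis
      by (rule has_sum_cong_neutral[THEN iffD1, rotated -1]) (auto simp: c'_def l'_def that(2))
  qed
  have "\<forall>i. l' i \<in> L \<and> 0 \<le> l' i"
    using l \<open>0 \<in> L\<close> \<open>countable I\<close> by (auto simp: l'_def)
  moreover have "((\<lambda>i. cmod (c' i) * exp (- \<sigma> * l' i)) has_sum M) UNIV"
    using *[of "\<lambda>c l. cmod c * exp (- \<sigma> * l)"] M(1) by simp
  moreover have "((\<lambda>i. c' i * exp (- s * of_real (l' i))) has_sum f s) UNIV" if "\<sigma> \<le> Re s" for s
  proof -
    have "(\<lambda>i. c i * exp (- s * of_real (l i))) summable_on I"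
      using summable_gds_terms[OF has_sum_imp_summable[OF M(1)] _ that] l by blast
    then have "((\<lambda>i. c i * exp (- s * of_real (l i))) has_sum f s) I"
      unfolding f[OF that] by simp
    then show ?thesis
      using *[of "\<lambda>c l. c * exp (- s * of_real l)"] by simp
  qed
  ultimately show ?thesis
    unfolding gds_def using M(2) by blast
qed

section \<open>Constants, change of the line, and pointwise bounds\<close>

lemma gds_const: "0 \<in> L \<Longrightarrow> cmod z \<le> N \<Longrightarrow> gds L \<sigma> N (\<lambda>_. z)"
  by (rule gdsI[of "{()}" _ "\<lambda>_. 0" "\<lambda>_. z"]) (auto intro!: has_sum_finiteI)

lemma gds_mono:
  assumes "gds L \<sigma> N f" "L \<subseteq> L'" "\<sigma> \<le> \<sigma>'" "N \<le> N'"
  shows "gds L' \<sigma>' N' f"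
proof -
  obtain c l M where l: "\<And>i. l i \<in> L \<and> 0 \<le> l i" and M: "M \<le> N"
      "((\<lambda>i. cmod (c i) * exp (- \<sigma> * l i)) has_sum M) (UNIV::nat set)"
    and f: "\<And>s. \<sigma> \<le> Re s \<Longrightarrow> ((\<lambda>i. c i * exp (- s * of_real (l i))) has_sum f s) UNIV"
    using assms(1) unfolding gds_def by blast
  have le: "cmod (c i) * exp (- \<sigma>' * l i) \<le> cmod (c i) * exp (- \<sigma> * l i)" for i
    by (intro mult_left_mono exp_frequency_mono) (use l assms in auto)
  have "(\<lambda>i. cmod (c i) * exp (- \<sigma>' * l i)) summable_on UNIV"
    by (rule summable_on_comparison_test[OF has_sum_imp_summable[OF M(2)]]) (use le in auto)
  then obtain M' where M': "((\<lambda>i. cmod (c i) * exp (- \<sigma>' * l i)) has_sum M') UNIV"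
    by (auto simp: summable_on_def)
  have "M' \<le> M"
    by (rule has_sum_mono[OF M' M(2)]) (use le in auto)
  then have "M' \<le> N'" using M assms by linarith
  then show ?thesis
    unfolding gds_def using l assms(2,3) f M'
    by (intro exI[of _ c] exI[of _ l]) force
qed

text \<open>On moving from \<sigma> to \<sigma>', a term of frequency at least \<open>r\<close>
  shrinks by at least the factor exp (- (\<sigma>' - \<sigma>) r). For \<open>r > 0\<close>, that is
  without constant term, the norm therefore decays exponentially to the right.\<close>

lemma gds_decay:
  assumes "gds L \<sigma> N f" "L \<subseteq> {r..}" "\<sigma> \<le> \<sigma>'"
  shows "gds L \<sigma>' (N * exp (- (\<sigma>' - \<sigma>) * r)) f"
proof -
  obtain c l M where l: "\<And>i. l i \<in> L \<and> 0 \<le> l i" and M: "M \<le> N"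
      "((\<lambda>i. cmod (c i) * exp (- \<sigma> * l i)) has_sum M) (UNIV::nat set)"
    and f: "\<And>s. \<sigma> \<le> Re s \<Longrightarrow> ((\<lambda>i. c i * exp (- s * of_real (l i))) has_sum f s) UNIV"
    using assms(1) unfolding gds_def by blast
  have le: "cmod (c i) * exp (- \<sigma>' * l i) \<le> cmod (c i) * exp (- \<sigma> * l i) * exp (- (\<sigma>' - \<sigma>) * r)" for i
  proof -
    have "exp (- \<sigma>' * l i) = exp (- \<sigma> * l i) * exp (- (\<sigma>' - \<sigma>) * l i)"
      by (simp add: exp_add[symmetric] algebra_simps)
    also have "\<dots> \<le> exp (- \<sigma> * l i) * exp (- (\<sigma>' - \<sigma>) * r)"
      using l[of i] assms(2,3) by (intro mult_left_mono) (auto intro: mult_left_mono_neg)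
    finally show ?thesis by (simp add: mult_left_mono mult.assoc)
  qed
  have M2: "((\<lambda>i. cmod (c i) * exp (- \<sigma> * l i) * exp (- (\<sigma>' - \<sigma>) * r)) has_sum M * exp (- (\<sigma>' - \<sigma>) * r)) UNIV"
    by (rule has_sum_cmult_left[OF M(2)])
  have "(\<lambda>i. cmod (c i) * exp (- \<sigma>' * l i)) summable_on UNIV"
    by (rule summable_on_comparison_test[OF has_sum_imp_summable[OF M2]]) (use le in auto)
  then obtain M' where M': "((\<lambda>i. cmod (c i) * exp (- \<sigma>' * l i)) has_sum M') UNIV"
    by (auto simp: summable_on_def)
  have "M' \<le> M * exp (- (\<sigma>' - \<sigma>) * r)"
    by (rule has_sum_mono[OF M' M2]) (use le in auto)
  also have "\<dots> \<le> N * exp (- (\<sigma>' - \<sigma>) * r)"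
    using M(1) by (intro mult_right_mono) auto
  finally show ?thesis
    unfolding gds_def using l f M' assms(3)
    by (intro exI[of _ c] exI[of _ l]) force
qed

lemma gds_norm_le:
  assumes "gds L \<sigma> N f" "\<sigma> \<le> Re s"
  shows "cmod (f s) \<le> N"
proof -
  obtain c l M where l: "\<And>i. l i \<in> L \<and> 0 \<le> l i" and M: "M \<le> N"
      "((\<lambda>i. cmod (c i) * exp (- \<sigma> * l i)) has_sum M) (UNIV::nat set)"
    and f: "\<And>s. \<sigma> \<le> Re s \<Longrightarrow> ((\<lambda>i. c i * exp (- s * of_real (l i))) has_sum f s) UNIV"
    using assms(1) unfolding gds_def by blast
  have "cmod (f s) \<le> M"
    by (rule norm_infsum_le[OF f[OF assms(2)] M(2)], unfold norm_gds_term)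
      (intro mult_left_mono exp_frequency_mono, use l assms in auto)
  with M show ?thesis by simp
qed

lemma gds_nonneg: "gds L \<sigma> N f \<Longrightarrow> 0 \<le> N"
  using order_trans[OF norm_ge_zero gds_norm_le[of L \<sigma> N f "of_real \<sigma>"]] by simp

text \<open>Multiplying terms adds frequencies and multiplies the weighted absolute values, so the
  weighted l1-norm is submultiplicative, as in a convolution algebra. The product is indexed by
  pairs.\<close>

lemma gds_mult:
  assumes "gds L \<sigma> N f" "gds L \<sigma> N' g" and L: "0 \<in> L" "\<And>x y. x \<in> L \<Longrightarrow> y \<in> L \<Longrightarrow> x + y \<in> L"
  shows "gds L \<sigma> (N * N') (\<lambda>s. f s * g s)"
proof -
  obtain c l M where l: "\<And>i. l i \<in> L \<and> 0 \<le> l i" and M: "M \<le> N"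
      "((\<lambda>i. cmod (c i) * exp (- \<sigma> * l i)) has_sum M) (UNIV::nat set)"
    and f: "\<And>s. \<sigma> \<le> Re s \<Longrightarrow> ((\<lambda>i. c i * exp (- s * of_real (l i))) has_sum f s) UNIV"
    using assms(1) unfolding gds_def by blast
  obtain d k M' where k: "\<And>i. k i \<in> L \<and> 0 \<le> k i" and M': "M' \<le> N'"
      "((\<lambda>i. cmod (d i) * exp (- \<sigma> * k i)) has_sum M') (UNIV::nat set)"
    and g: "\<And>s. \<sigma> \<le> Re s \<Longrightarrow> ((\<lambda>i. d i * exp (- s * of_real (k i))) has_sum g s) UNIV"
    using assms(2) unfolding gds_def by blast
  let ?c = "\<lambda>(i,j). c i * d j" and ?l = "\<lambda>(i,j). l i + k j"
  have eq: "cmod (c i * d j) * exp (- \<sigma> * (l i + k j)) =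
      (cmod (c i) * exp (- \<sigma> * l i)) * (cmod (d j) * exp (- \<sigma> * k j))" for i j
    by (simp add: norm_mult exp_add[symmetric] algebra_simps)
  have inner: "((\<lambda>j. (cmod (c i) * exp (- \<sigma> * l i)) * (cmod (d j) * exp (- \<sigma> * k j)))
      has_sum (cmod (c i) * exp (- \<sigma> * l i)) * M') UNIV" for i
    by (rule has_sum_cmult_right[OF M'(2)])
  have outer: "((\<lambda>i. (cmod (c i) * exp (- \<sigma> * l i)) * M') has_sum M * M') UNIV"
    by (rule has_sum_cmult_left[OF M(2)])
  have "(\<lambda>p. cmod (?c p) * exp (- \<sigma> * ?l p)) summable_on (UNIV \<times> UNIV)"
    by (rule summable_on_SigmaI[OF _ has_sum_imp_summable[OF outer]]) (simp_all only: eq prod.case inner, auto)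
  then have hs: "((\<lambda>p. cmod (?c p) * exp (- \<sigma> * ?l p)) has_sum M * M') (UNIV \<times> UNIV)"
    by (intro has_sum_SigmaI[OF _ outer]) (simp_all only: eq prod.case inner)
  show ?thesis
  proof (rule gdsI[OF _ L(1) _ hs])
    show "M * M' \<le> N * N'"
      using M M' has_sum_nonneg[OF M(2)] has_sum_nonneg[OF M'(2)] by (intro mult_mono) auto
    show "f s * g s = (\<Sum>\<^sub>\<infinity>p\<in>UNIV \<times> UNIV. ?c p * exp (- s * of_real (?l p)))" if s: "\<sigma> \<le> Re s" for s
    proof -
      let ?F = "\<lambda>p. ?c p * exp (- s * of_real (?l p))"
      have eq: "c i * d j * exp (- s * of_real (l i + k j)) =
          c i * exp (- s * of_real (l i)) * (d j * exp (- s * of_real (k j)))" for i j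
        by (simp add: exp_add[symmetric] algebra_simps)
      have "?F summable_on (UNIV \<times> UNIV)"
        using summable_gds_terms[OF has_sum_imp_summable[OF hs] _ s] l k by (auto simp: add_nonneg_nonneg)
      then have "(?F has_sum f s * g s) (UNIV \<times> UNIV)"
        by (intro has_sum_SigmaI[where g = "\<lambda>i. c i * exp (- s * of_real (l i)) * g s"])
          (simp_all only: eq prod.case has_sum_cmult_right has_sum_cmult_left f[OF s] g[OF s])
      then show ?thesis by (simp add: infsumI)
    qed
  qed (use l k L in \<open>auto simp: add_nonneg_nonneg\<close>)
qed

text \<open>Completeness of the weighted l1-space: Tonelli for the weights makes the double series
  absolutely summable, and Fubini then identifies its sum with the iterated one.\<close>

lemma gds_suminf:
  fixes f :: "nat \<Rightarrow> complex \<Rightarrow> complex"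
  assumes f: "\<And>j. gds L \<sigma> (N j) (f j)" and "summable N" and L: "0 \<in> L"
  shows "gds L \<sigma> (suminf N) (\<lambda>s. \<Sum>j. f j s)"
proof -
  have "\<forall>j. \<exists>c l M. (\<forall>i. l i \<in> L \<and> 0 \<le> l i) \<and> M \<le> N j \<and>
      ((\<lambda>i. cmod (c i) * exp (- \<sigma> * l i)) has_sum M) (UNIV::nat set) \<and>
      (\<forall>s. \<sigma> \<le> Re s \<longrightarrow> ((\<lambda>i. c i * exp (- s * of_real (l i))) has_sum f j s) UNIV)"
    using f unfolding gds_def by blast
  then obtain c :: "nat \<Rightarrow> nat \<Rightarrow> complex" and l M where l: "\<And>j i. l j i \<in> L \<and> 0 \<le> l j i"
    and M: "\<And>j. M j \<le> N j"
      "\<And>j. ((\<lambda>i. cmod (c j i) * exp (- \<sigma> * l j i)) has_sum M j) UNIV"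
    and fs: "\<And>j s. \<sigma> \<le> Re s \<Longrightarrow> ((\<lambda>i. c j i * exp (- s * of_real (l j i))) has_sum f j s) UNIV"
    unfolding choice_iff by blast
  have M0: "0 \<le> M j" for j
    using has_sum_nonneg[OF M(2)] by simp
  have "summable M"
    by (rule summable_comparison_test'[OF \<open>summable N\<close>]) (use M M0 in auto)
  then have outer: "(M has_sum suminf M) UNIV"
    using M0 by (intro sums_nonneg_imp_has_sum summable_sums) auto
  let ?c = "\<lambda>(j,i). c j i" and ?l = "\<lambda>(j,i). l j i"
  have "(\<lambda>p. cmod (?c p) * exp (- \<sigma> * ?l p)) summable_on (UNIV \<times> UNIV)"
    by (rule summable_on_SigmaI[OF _ has_sum_imp_summable[OF outer]]) (use M(2) in auto)
  then have hs: "((\<lambda>p. cmod (?c p) * exp (- \<sigma> * ?l p)) has_sum suminf M) (UNIV \<times> UNIV)"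
    by (intro has_sum_SigmaI[OF _ outer]) (use M(2) in auto)
  show ?thesis
  proof (rule gdsI[OF _ L(1) _ hs])
    show "suminf M \<le> suminf N"
      by (rule suminf_le) (use M \<open>summable M\<close> \<open>summable N\<close> in auto)
    show "(\<Sum>j. f j s) = (\<Sum>\<^sub>\<infinity>p\<in>UNIV \<times> UNIV. ?c p * exp (- s * of_real (?l p)))" if s: "\<sigma> \<le> Re s" for s
    proof -
      let ?F = "\<lambda>p. ?c p * exp (- s * of_real (?l p))"
      have "?F summable_on (UNIV \<times> UNIV)"
        using summable_gds_terms[OF has_sum_imp_summable[OF hs] _ s] l by auto
      then have "(?F has_sum infsum ?F (UNIV \<times> UNIV)) (UNIV \<times> UNIV)"
        by simp
      then have "((\<lambda>j. f j s) has_sum infsum ?F (UNIV \<times> UNIV)) UNIV"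
        by (rule has_sum_SigmaD) (use fs[OF s] in auto)
      then show ?thesis
        by (simp add: has_sum_imp_sums sums_unique[symmetric])
    qed
  qed (use l in auto)
qed

lemma gds_add:
  assumes "gds L \<sigma> N f" "gds L \<sigma> N' g" "0 \<in> L"
  shows "gds L \<sigma> (N + N') (\<lambda>s. f s + g s)"
proof -
  define h where "h j = (if j = 0 then f else if j = 1 then g else (\<lambda>_. 0))" for j :: nat
  define K where "K j = (if j = 0 then N else if j = 1 then N' else 0)" for j :: nat
  have "gds L \<sigma> (suminf K) (\<lambda>s. \<Sum>j. h j s)"
  proof (rule gds_suminf)
    show "gds L \<sigma> (K j) (h j)" for j
      using assms gds_const[of L 0 0 \<sigma>] by (auto simp: h_def K_def)
    show "summable K"
      by (rule summable_finite[of "{0,1}"]) (auto simp: K_def)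
  qed fact
  moreover have "(\<Sum>j. h j s) = f s + g s" for s
    by (subst suminf_finite[of "{0,1}"]) (auto simp: h_def)
  moreover have "suminf K = N + N'"
    by (subst suminf_finite[of "{0,1}"]) (auto simp: K_def)
  ultimately show ?thesis by simp
qed

section \<open>Power series, exponential and logarithm\<close>

lemma gds_power:
  assumes "gds L \<sigma> N f" "0 \<in> L" "\<And>x y. x \<in> L \<Longrightarrow> y \<in> L \<Longrightarrow> x + y \<in> L"
  shows "gds L \<sigma> (N ^ n) (\<lambda>s. f s ^ n)"
proof (induction n)
  case 0
  show ?case using gds_const[OF assms(2), of 1] by simp
next
  case (Suc n)
  show ?case using gds_mult[OF assms(1) Suc assms(2,3)] by simp
qed

lemma gds_cmult:
  assumes "gds L \<sigma> N f" "0 \<in> L" "\<And>x y. x \<in> L \<Longrightarrow> y \<in> L \<Longrightarrow> x + y \<in> L"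
  shows "gds L \<sigma> (cmod z * N) (\<lambda>s. z * f s)"
  by (rule gds_mult[OF gds_const[OF assms(2) order_refl] assms])

lemma gds_power_series:
  assumes "gds L \<sigma> N f" "0 \<in> L" "\<And>x y. x \<in> L \<Longrightarrow> y \<in> L \<Longrightarrow> x + y \<in> L"
    and "summable (\<lambda>n. cmod (a n) * N ^ n)"
  shows "gds L \<sigma> (\<Sum>n. cmod (a n) * N ^ n) (\<lambda>s. \<Sum>n. a n * f s ^ n)"
  by (rule gds_suminf[OF gds_cmult[OF gds_power[OF assms(1-3)] assms(2,3)] assms(4,2)])

lemma gds_exp:
  assumes "gds L \<sigma> N f" "0 \<in> L" "\<And>x y. x \<in> L \<Longrightarrow> y \<in> L \<Longrightarrow> x + y \<in> L"
  shows "gds L \<sigma> (exp N) (\<lambda>s. exp (f s))"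
proof -
  have N: "summable (\<lambda>n. N ^ n / fact n)" "(\<Sum>n. N ^ n / fact n) = exp N"
    using exp_converges[of N] by (auto simp: sums_iff divide_inverse mult.commute)
  have "(\<Sum>n. (1 / fact n) * f s ^ n) = exp (f s)" for s
    using exp_converges[of "f s"] by (simp add: sums_iff scaleR_conv_of_real field_simps)
  with gds_power_series[OF assms, of "\<lambda>n. 1 / fact n"] N show ?thesis
    by (simp add: norm_divide)
qed

text \<open>For norm at most 1/2 the logarithmic series is dominated by the sum of 2^(-n) over n >=
  1, which is 1.\<close>

lemma gds_ln_one_plus:
  assumes "gds L \<sigma> N f" "0 \<in> L" "\<And>x y. x \<in> L \<Longrightarrow> y \<in> L \<Longrightarrow> x + y \<in> L" "N \<le> 1/2"
  shows "gds L \<sigma> 1 (\<lambda>s. Ln (1 + f s))"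
proof -
  have "0 \<le> N" by (rule gds_nonneg[OF assms(1)])
  \<comment> \<open>Division by zero gives \<open>a 0 = 0\<close>, so the series effectively starts
    at \<open>n = 1\<close>.\<close>
  define a :: "nat \<Rightarrow> complex" where "a n = (-1) ^ Suc n / of_nat n" for n
  have sums: "(\<lambda>n. a n * z ^ n) sums Ln (1 + z)" if "cmod z < 1" for z
    using Ln_series'[OF that] by (simp add: a_def power_minus[of z] mult_ac)
  have le: "cmod (a n) * N ^ n \<le> (1/2) * (1/2) ^ (n - 1)" for n
  proof (cases n)
    case (Suc m)
    have "cmod (a n) \<le> 1" by (simp add: a_def norm_divide norm_power Suc del: of_nat_Suc)
    moreover have "N ^ n \<le> (1/2) ^ n" by (rule power_mono) fact+
    ultimately show ?thesis
      using mult_mono[of "cmod (a n)" 1 "N ^ n" "(1/2) ^ n"] \<open>0 \<le> N\<close> Suc by simp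
  qed (auto simp: a_def)
  have "summable (\<lambda>n. (1/2) * (1/2::real) ^ n)"
    by (simp add: summable_geometric)
  then have "summable (\<lambda>n. cmod (a (Suc n)) * N ^ Suc n)"
    by (rule summable_comparison_test') (use le[of "Suc _"] \<open>0 \<le> N\<close> in \<open>auto simp: norm_mult\<close>)
  then have S: "summable (\<lambda>n. cmod (a n) * N ^ n)"
    by (subst (asm) summable_Suc_iff)
  have "(\<Sum>n. cmod (a n) * N ^ n) = (\<Sum>n. cmod (a (Suc n)) * N ^ Suc n)"
    using suminf_split_head[OF S] by (simp add: a_def)
  also have "\<dots> \<le> (\<Sum>n. (1/2) * (1/2::real) ^ n)"
    by (rule suminf_le) (use le[of "Suc _"] \<open>summable (\<lambda>n. cmod (a (Suc n)) * N ^ Suc n)\<close> in \<open>auto simp: summable_geometric\<close>)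
  also have "\<dots> = 1"
    using suminf_geometric[of "1/2::real"] by (subst suminf_mult) (auto simp: summable_geometric)
  finally have le1: "(\<Sum>n. cmod (a n) * N ^ n) \<le> 1" .
  have "gds L \<sigma> 1 (\<lambda>s. \<Sum>n. a n * f s ^ n)"
    by (rule gds_mono[OF gds_power_series[OF assms(1-3) S]]) (use le1 in auto)
  moreover have "(\<Sum>n. a n * f s ^ n) = Ln (1 + f s)" if "\<sigma> \<le> Re s" for s
    using sums[of "f s"] gds_norm_le[OF assms(1) that] assms(4) by (simp add: sums_iff)
  ultimately show ?thesis
    unfolding gds_def by auto
qed

text \<open>This makes negligible everything beyond a leading or constant term, provided that the
  frequencies stay away from 0.\<close>

lemma gds_eventually_small:
  assumes "gds L \<sigma> N f" "L \<subseteq> {r..}" "0 < r" "0 < \<epsilon>"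
  obtains \<sigma>0 where "\<sigma> \<le> \<sigma>0" "\<And>\<tau>. \<sigma>0 \<le> \<tau> \<Longrightarrow> gds L \<tau> \<epsilon> f"
proof -
  have "((\<lambda>x. N * exp (- ((x - \<sigma>) * r))) \<longlongrightarrow> 0) at_top"
    using \<open>0 < r\<close> by real_asymp
  then have "eventually (\<lambda>x. N * exp (- ((x - \<sigma>) * r)) < \<epsilon>) at_top"
    using \<open>0 < \<epsilon>\<close> by (rule order_tendstoD)
  then have "eventually (\<lambda>x. N * exp (- (x - \<sigma>) * r) < \<epsilon> \<and> \<sigma> \<le> x) at_top"
    using eventually_ge_at_top[of \<sigma>] by eventually_elim (simp only: mult_minus_left)
  then obtain \<sigma>0 where *: "N * exp (- (\<sigma>0 - \<sigma>) * r) < \<epsilon>" "\<sigma> \<le> \<sigma>0"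
    by (auto simp: eventually_at_top_linorder)
  have "gds L \<tau> \<epsilon> f" if "\<sigma>0 \<le> \<tau>" for \<tau>
    by (rule gds_mono[OF gds_decay[OF assms(1,2) *(2)]]) (use * that in auto)
  with * that show thesis by blast
qed

lemma gds_cong:
  assumes "gds L \<sigma> N f" "\<And>s. \<sigma> \<le> Re s \<Longrightarrow> f s = g s"
  shows "gds L \<sigma> N g"
  using assms unfolding gds_def by auto

text \<open>This is division by a monomial of frequency \<open>r\<close>. All frequencies drop by
  \<open>r\<close>, and the lower bound on \<open>L\<close> keeps them nonnegative.\<close>

lemma gds_shift:
  assumes "gds L \<sigma> N f" "L \<subseteq> {r..}"
  shows "gds ((\<lambda>l. l - r) ` L) \<sigma> (N * (cmod z * exp (\<sigma> * r))) (\<lambda>s. z * exp (s * of_real r) * f s)"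
proof -
  obtain c l M where l: "\<And>i. l i \<in> L \<and> 0 \<le> l i" and M: "M \<le> N"
      "((\<lambda>i. cmod (c i) * exp (- \<sigma> * l i)) has_sum M) (UNIV::nat set)"
    and f: "\<And>s. \<sigma> \<le> Re s \<Longrightarrow> ((\<lambda>i. c i * exp (- s * of_real (l i))) has_sum f s) UNIV"
    using assms(1) unfolding gds_def by blast
  have "((\<lambda>i. cmod (c i) * exp (- \<sigma> * l i) * (cmod z * exp (\<sigma> * r))) has_sum M * (cmod z * exp (\<sigma> * r))) UNIV"
    by (rule has_sum_cmult_left[OF M(2)])
  moreover have "cmod (c i) * exp (- \<sigma> * l i) * (cmod z * exp (\<sigma> * r)) = cmod (z * c i) * exp (- \<sigma> * (l i - r))" for i
    by (simp add: norm_mult exp_add[symmetric] algebra_simps)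
  ultimately have 1: "((\<lambda>i. cmod (z * c i) * exp (- \<sigma> * (l i - r))) has_sum M * (cmod z * exp (\<sigma> * r))) UNIV"
    by simp
  have 2: "((\<lambda>i. z * c i * exp (- s * of_real (l i - r))) has_sum z * exp (s * of_real r) * f s) UNIV"
    if "\<sigma> \<le> Re s" for s
  proof -
    have "((\<lambda>i. z * exp (s * of_real r) * (c i * exp (- s * of_real (l i)))) has_sum z * exp (s * of_real r) * f s) UNIV"
      by (rule has_sum_cmult_right[OF f[OF that]])
    moreover have "z * exp (s * of_real r) * (c i * exp (- s * of_real (l i))) = z * c i * exp (- s * of_real (l i - r))" for i
      by (simp add: exp_add[symmetric] algebra_simps)
    ultimately show ?thesis by (simp only:)
  qed
  have 3: "l i - r \<in> (\<lambda>l. l - r) ` L \<and> 0 \<le> l i - r" for i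
    using l[of i] assms(2) by auto
  have 4: "M * (cmod z * exp (\<sigma> * r)) \<le> N * (cmod z * exp (\<sigma> * r))"
    using M by (intro mult_right_mono) auto
  show ?thesis
    unfolding gds_def
    by (rule exI[of _ "\<lambda>i. z * c i"], rule exI[of _ "\<lambda>i. l i - r"]) (use 1 2 3 4 in blast)
qed

text \<open>The summands of the weighted norm are a majorant on the whole closed half-plane, so the
  partial sums converge uniformly there by the Weierstrass M-test.\<close>

lemma gds_holomorphic:
  assumes "gds L \<sigma> N f"
  shows "f holomorphic_on {s. \<sigma> < Re s}"
proof -
  obtain c l M where l: "\<And>i. l i \<in> L \<and> 0 \<le> l i" and M: "M \<le> N"
      "((\<lambda>i. cmod (c i) * exp (- \<sigma> * l i)) has_sum M) (UNIV::nat set)"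
    and f: "\<And>s. \<sigma> \<le> Re s \<Longrightarrow> ((\<lambda>i. c i * exp (- s * of_real (l i))) has_sum f s) UNIV"
    using assms(1) unfolding gds_def by blast
  have op: "open {s. \<sigma> < Re s}"
    by (simp add: open_halfspace_Re_gt)
  have bound: "norm (c i * exp (- s * of_real (l i))) \<le> cmod (c i) * exp (- \<sigma> * l i)"
    if "s \<in> {s. \<sigma> \<le> Re s}" for i s
    unfolding norm_gds_term by (intro mult_left_mono exp_frequency_mono) (use l that in auto)
  have "uniform_limit {s. \<sigma> \<le> Re s} (\<lambda>n s. \<Sum>i<n. c i * exp (- s * of_real (l i)))
      (\<lambda>s. \<Sum>i. c i * exp (- s * of_real (l i))) sequentially"
    by (rule Weierstrass_m_test[OF bound]) (use summable_on_imp_summable[OF has_sum_imp_summable[OF M(2)]] in auto)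
  then have ul: "uniform_limit {s. \<sigma> \<le> Re s} (\<lambda>n s. \<Sum>i<n. c i * exp (- s * of_real (l i))) f sequentially"
    by (rule uniform_limit_cong'[THEN iffD1, rotated 2])
      (use sums_unique[OF has_sum_imp_sums[OF f]] in auto)
  show ?thesis
  proof (rule holomorphic_uniform_sequence[OF op])
    show "(\<lambda>s. \<Sum>i<n. c i * exp (- s * of_real (l i))) holomorphic_on {s. \<sigma> < Re s}" for n
      by (intro holomorphic_intros)
    show "\<exists>d>0. cball x d \<subseteq> {s. \<sigma> < Re s} \<and>
        uniform_limit (cball x d) (\<lambda>n s. \<Sum>i<n. c i * exp (- s * of_real (l i))) f sequentially"
      if x: "x \<in> {s. \<sigma> < Re s}" for x
    proof -
      obtain d where d: "d > 0" "cball x d \<subseteq> {s. \<sigma> < Re s}"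
        using x op open_contains_cball by blast
      moreover have "cball x d \<subseteq> {s. \<sigma> \<le> Re s}"
        using d by fastforce
      ultimately show ?thesis
        using uniform_limit_on_subset[OF ul] by blast
    qed
  qed
qed

subsection \<open>Ordinary Dirichlet series\<close>

lemma of_nat_powr_eq_exp: "0 < n \<Longrightarrow> (of_nat n :: complex) powr (- s) = exp (- s * of_real (ln (real n)))"
  by (auto simp: powr_def Ln_of_nat)

lemma dirichlet_term_eq: "dirichlet_term a s n = a (Suc n) * exp (- s * of_real (ln (real (Suc n))))"
  unfolding dirichlet_term_def by (subst of_nat_powr_eq_exp) auto

lemma norm_dirichlet_term: "cmod (dirichlet_term a s n) = cmod (a (Suc n)) * real (Suc n) powr (- Re s)"
  unfolding dirichlet_term_eq norm_gds_term by (simp add: powr_def)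

text \<open>The abscissas of convergence and of absolute convergence differ by at most 1: terms are
  bounded at a point of convergence, and a further shift by more than 1 makes them summable.\<close>

lemma dirichlet_represents_imp_abs_summable:
  assumes "dirichlet_represents b (half_plane \<nu>) f" "\<nu> + 1 < \<sigma>"
  shows "summable (\<lambda>n. cmod (b (Suc n)) * real (Suc n) powr (- \<sigma>))"
proof -
  \<comment> \<open>Half of the surplus over 1: convergence is used at
    \<open>\<nu> + \<delta>\<close>, and the remaining distance to \<sigma> is exactly
    \<open>1 + \<delta>\<close>.\<close>
  define \<delta> where "\<delta> = (\<sigma> - \<nu> - 1) / 2"
  have \<delta>: "0 < \<delta>" using assms by (simp add: \<delta>_def)
  define s where "s = complex_of_real (\<nu> + \<delta>)"
  have "summable (dirichlet_term b s)"
    using assms(1) \<delta> unfolding dirichlet_represents_def half_plane_def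
    by (intro sums_summable[of _ "f s"]) (simp add: s_def)
  then have "Bseq (dirichlet_term b s)"
    by (intro convergent_imp_Bseq convergentI[OF summable_LIMSEQ_zero])
  then obtain K where K: "\<And>n. cmod (dirichlet_term b s n) \<le> K"
    unfolding Bseq_def by blast
  have "summable (\<lambda>n. real n powr (- (1 + \<delta>)))"
    using \<delta> by (subst summable_real_powr_iff) auto
  then have "summable (\<lambda>n. real (Suc n) powr (- (1 + \<delta>)))"
    by (subst summable_Suc_iff)
  then have "summable (\<lambda>n. K * real (Suc n) powr (- (1 + \<delta>)))"
    by (rule summable_mult)
  then show ?thesis
  proof (rule summable_comparison_test'[where N = 0])
    fix n
    have "- \<sigma> = - (\<nu> + \<delta>) + - (1 + \<delta>)"
      by (simp add: \<delta>_def field_simps)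
    then have "cmod (b (Suc n)) * real (Suc n) powr (- \<sigma>) = 
        cmod (dirichlet_term b s n) * real (Suc n) powr (- (1 + \<delta>))"
      unfolding norm_dirichlet_term by (simp only: powr_add s_def Re_complex_of_real mult.assoc)
    also have "\<dots> \<le> K * real (Suc n) powr (- (1 + \<delta>))"
      by (intro mult_right_mono K) auto
    finally show "norm (cmod (b (Suc n)) * real (Suc n) powr (- \<sigma>)) \<le> K * real (Suc n) powr (- (1 + \<delta>))"
      by simp
  qed
qed

text \<open>Because of the index shift, the first \<open>m\<close> terms belong to the integers 1,
  ..., \<open>m\<close>, so only frequencies above ln m survive.\<close>

lemma dirichlet_tail_gds:
  assumes "dirichlet_represents b (half_plane \<nu>) f" "\<nu> + 1 < \<sigma>"
  obtains N where "gds {ln (real k) |k. m < k} \<sigma> N (\<lambda>s. f s - (\<Sum>n<m. dirichlet_term b s n))"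
proof -
  have abs: "summable (\<lambda>n. cmod (b (Suc n)) * real (Suc n) powr (- \<sigma>))"
    by (rule dirichlet_represents_imp_abs_summable[OF assms])
  define c where "c i = b (Suc (i + m))" for i
  define l where "l i = ln (real (Suc (i + m)))" for i
  have "summable (\<lambda>i. cmod (c i) * exp (- \<sigma> * l i))"
    using summable_ignore_initial_segment[OF abs, of m] by (simp add: c_def l_def powr_def)
  then have "(\<lambda>i. cmod (c i) * exp (- \<sigma> * l i)) summable_on UNIV"
    by (rule summable_nonneg_imp_summable_on) auto
  then obtain M where M: "((\<lambda>i. cmod (c i) * exp (- \<sigma> * l i)) has_sum M) UNIV"
    by (auto simp: summable_on_def)
  have l: "l i \<in> {ln (real k) |k. m < k} \<and> 0 \<le> l i" for i
    unfolding l_def by (intro conjI CollectI exI[of _ "Suc (i + m)"]) auto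
  have f: "((\<lambda>i. c i * exp (- s * of_real (l i))) has_sum f s - (\<Sum>n<m. dirichlet_term b s n)) UNIV"
    if s: "\<sigma> \<le> Re s" for s
  proof -
    have "(\<lambda>n. dirichlet_term b s n) sums f s"
      using assms s by (auto simp: dirichlet_represents_def half_plane_def)
    then have "(\<lambda>i. c i * exp (- s * of_real (l i))) sums (f s - (\<Sum>n<m. dirichlet_term b s n))"
      by (subst (asm) sums_iff_shift'[of _ m, symmetric]) (simp add: dirichlet_term_eq c_def l_def)
    moreover have "((\<lambda>i. c i * exp (- s * of_real (l i))) has_sum infsum (\<lambda>i. c i * exp (- s * of_real (l i))) UNIV) UNIV"
      using summable_gds_terms[OF has_sum_imp_summable[OF M] _ s] l by simp
    ultimately show ?thesis
      using has_sum_imp_sums sums_unique2 by metis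
  qed
  have "gds {ln (real k) |k. m < k} \<sigma> M (\<lambda>s. f s - (\<Sum>n<m. dirichlet_term b s n))"
    unfolding gds_def by (rule exI[of _ c], rule exI[of _ l]) (use M f l in blast)
  then show thesis by (rule that)
qed

text \<open>Divide the tail by the leading term. The resulting frequencies are at least ln ((m + 1)
  / m) > 0, so the quotient \<open>u\<close> is as small as desired far to the right.\<close>

lemma dirichlet_leading_term:
  assumes rep: "dirichlet_represents b (half_plane \<nu>) f" and m: "0 < m" "b m \<noteq> 0" "\<And>k. 0 < k \<Longrightarrow> k < m \<Longrightarrow> b k = 0"
    and "0 < \<epsilon>"
  obtains \<sigma> u where "\<nu> + 1 < \<sigma>" "\<And>\<tau>. \<sigma> \<le> \<tau> \<Longrightarrow> gds {ln (real k / real m) |k. m < k} \<tau> \<epsilon> u"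
    "\<And>s. \<sigma> \<le> Re s \<Longrightarrow> f s = b m * exp (- s * of_real (ln (real m))) * (1 + u s)"
proof -
  define \<sigma>1 where "\<sigma>1 = \<nu> + 2"
  have \<sigma>1: "\<nu> + 1 < \<sigma>1" by (simp add: \<sigma>1_def)
  obtain N where N: "gds {ln (real k) |k. m < k} \<sigma>1 N (\<lambda>s. f s - (\<Sum>n<m. dirichlet_term b s n))"
    using dirichlet_tail_gds[OF rep \<sigma>1] by blast
  have sum: "(\<Sum>n<m. dirichlet_term b s n) = b m * exp (- s * of_real (ln (real m)))" for s
  proof -
    obtain p where p: "m = Suc p" using m by (cases m) auto
    have "(\<Sum>n<p. dirichlet_term b s n) = 0"
      using m(3) p by (intro sum.neutral) (auto simp: dirichlet_term_def)
    then show ?thesis by (simp add: p dirichlet_term_eq)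
  qed
  define u where "u s = 1 / b m * exp (s * of_real (ln (real m))) * (f s - (\<Sum>n<m. dirichlet_term b s n))" for s
  have "{ln (real k) |k. m < k} \<subseteq> {ln (real m)..}"
    using m by auto
  from gds_shift[OF N this, of "1 / b m"]
  obtain N' where "gds ((\<lambda>l. l - ln (real m)) ` {ln (real k) |k. m < k}) \<sigma>1 N' u"
    unfolding u_def by blast
  moreover have "(\<lambda>l. l - ln (real m)) ` {ln (real k) |k. m < k} \<subseteq> {ln (real k / real m) |k. m < k}"
    using m by (force simp: ln_div)
  ultimately have u: "gds {ln (real k / real m) |k. m < k} \<sigma>1 N' u"
    by (rule gds_mono) auto
  have "{ln (real k / real m) |k. m < k} \<subseteq> {ln (real (Suc m) / real m)..}"
    using m by (auto intro!: divide_right_mono)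
  moreover have "0 < ln (real (Suc m) / real m)"
    using m by (intro ln_gt_zero) simp
  ultimately obtain \<sigma> where "\<sigma>1 \<le> \<sigma>" "\<And>\<tau>. \<sigma> \<le> \<tau> \<Longrightarrow> gds {ln (real k / real m) |k. m < k} \<tau> \<epsilon> u"
    using gds_eventually_small[OF u _ _ \<open>0 < \<epsilon>\<close>] by blast
  moreover have "f s = b m * exp (- s * of_real (ln (real m))) * (1 + u s)" for s
    using m(2) by (simp add: u_def sum exp_minus field_simps)
  ultimately show thesis
    using \<sigma>1 by (intro that[of \<sigma> u]) auto
qed

subsection \<open>Mean values and uniqueness of coefficients\<close>

text \<open>For \<open>w \<noteq> 1\<close> the geometric sums are bounded by 2 / |w - 1|, hence
  vanish after division by n.\<close>

lemma geometric_mean_tendsto: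
  fixes w :: complex
  assumes "cmod w = 1"
  shows "(\<lambda>n. (\<Sum>j<n. w ^ j) / of_nat n) \<longlonglongrightarrow> (if w = 1 then 1 else 0)"
proof (cases "w = 1")
  case True
  have "(\<lambda>n. (\<Sum>j<n. w ^ j) / of_nat n) \<longlonglongrightarrow> 1"
    by (rule tendsto_eventually, use eventually_gt_at_top[of 0] in eventually_elim) (use True in simp)
  with True show ?thesis by simp
next
  case False
  have "(\<lambda>n. (2 / cmod (w - 1)) / real n) \<longlonglongrightarrow> 0"
    by (rule lim_const_over_n)
  then have "(\<lambda>n. (\<Sum>j<n. w ^ j) / of_nat n) \<longlonglongrightarrow> 0"
  proof (rule Lim_null_comparison[rotated], intro always_eventually allI)
    fix n
    have "cmod (w ^ n - 1) \<le> 2"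
      using norm_triangle_ineq4[of "w ^ n" 1] assms by (simp add: norm_power)
    then show "norm ((\<Sum>j<n. w ^ j) / of_nat n) \<le> 2 / cmod (w - 1) / real n"
      using False divide_right_mono[of "cmod (w ^ n - 1)" 2 "cmod (w - 1) * real n"]
      by (simp add: geometric_sum norm_divide norm_mult)
  qed
  with False show ?thesis by simp
qed

text \<open>At the j-th sample point the i-th summand equals \<open>d i * w i ^ j\<close> with
  \<open>w i\<close> unimodular. Averaging over j kills it unless \<open>w i = 1\<close>; the
  hypothesis on \<tau> says that this happens only at the frequency \<open>q\<close>, where
  \<open>d i = c i\<close>.\<close>

lemma gds_mean_value:
  fixes c :: "nat \<Rightarrow> complex"
  assumes M: "summable (\<lambda>i. cmod (c i) * exp (- \<sigma> * l i))"
    and f: "\<And>s. \<sigma> \<le> Re s \<Longrightarrow> (\<lambda>i. c i * exp (- s * of_real (l i))) sums f s"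
    and \<tau>: "\<And>i. l i \<noteq> q \<Longrightarrow> exp (\<i> * of_real (\<tau> * (q - l i))) \<noteq> 1"
  shows "(\<lambda>n. (\<Sum>j<n. f (Complex \<sigma> (real j * \<tau>)) * exp (Complex \<sigma> (real j * \<tau>) * of_real q)) / of_nat n)
    \<longlonglongrightarrow> (\<Sum>i. if l i = q then c i else 0)"
proof -
  define w where "w i = exp (\<i> * of_real (\<tau> * (q - l i)))" for i
  define A where "A w n = (\<Sum>j<n. w ^ j) / of_nat n" for w :: complex and n
  define d where "d i = c i * of_real (exp (\<sigma> * (q - l i)))" for i
  have nw: "cmod (w i) = 1" for i
    by (simp add: w_def)
  have nA: "cmod (A (w i) n) \<le> 1" for i n
  proof -
    have "cmod (\<Sum>j<n. w i ^ j) \<le> real n"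
      by (rule order_trans[OF norm_sum]) (simp add: norm_power nw)
    then show ?thesis by (cases "n = 0") (simp_all add: A_def norm_divide)
  qed
  have nd: "cmod (d i) = exp (\<sigma> * q) * (cmod (c i) * exp (- \<sigma> * l i))" for i
    by (simp add: d_def norm_mult exp_add[symmetric] algebra_simps)
  have eq: "(\<Sum>j<n. f (Complex \<sigma> (real j * \<tau>)) * exp (Complex \<sigma> (real j * \<tau>) * of_real q)) / of_nat n
      = (\<Sum>i. d i * A (w i) n)" for n
  proof -
    have "(\<lambda>i. d i * w i ^ j) sums (f (Complex \<sigma> (real j * \<tau>)) * exp (Complex \<sigma> (real j * \<tau>) * of_real q))" for j
    proof -
      have e: "d i * w i ^ j = c i * exp (- Complex \<sigma> (real j * \<tau>) * of_real (l i)) * exp (Complex \<sigma> (real j * \<tau>) * of_real q)" for i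
      proof -
        have "w i ^ j = exp (of_nat j * (\<i> * of_real (\<tau> * (q - l i))))"
          unfolding w_def by (rule exp_of_nat_mult[symmetric])
        moreover have "exp (- Complex \<sigma> (real j * \<tau>) * of_real (l i)) * exp (Complex \<sigma> (real j * \<tau>) * of_real q)
            = exp (of_real (\<sigma> * (q - l i))) * exp (of_nat j * (\<i> * of_real (\<tau> * (q - l i))))"
          by (simp add: exp_add[symmetric] Complex_eq algebra_simps)
        ultimately show ?thesis by (simp only: d_def exp_of_real mult.assoc)
      qed
      show ?thesis unfolding e by (rule sums_mult2[OF f]) simp
    qed
    then have "(\<lambda>i. \<Sum>j<n. d i * w i ^ j) sums
        (\<Sum>j<n. f (Complex \<sigma> (real j * \<tau>)) * exp (Complex \<sigma> (real j * \<tau>) * of_real q))"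
      by (intro sums_sum)
    from sums_divide[OF this, of "of_nat n"] show ?thesis
      by (simp add: sums_iff A_def sum_distrib_left)
  qed
  have "(\<lambda>n. \<Sum>i. d i * A (w i) n) \<longlonglongrightarrow> (\<Sum>i. d i * (if w i = 1 then 1 else 0))"
  \<comment> \<open>Limit and sum may be exchanged because averages of powers of a unimodular number
    are at most 1 in modulus, so \<open>cmod (d i)\<close> dominates.\<close>
  proof (rule tannerys_theorem[THEN conjunct2, THEN conjunct2])
    show "(\<lambda>n. d i * A (w i) n) \<longlonglongrightarrow> d i * (if w i = 1 then 1 else 0)" for i
      unfolding A_def by (intro tendsto_intros geometric_mean_tendsto nw)
    show "eventually (\<lambda>(i, n). norm (d i * A (w i) n) \<le> cmod (d i)) (at_top \<times>\<^sub>F sequentially)"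
      using nA by (intro always_eventually) (auto simp: norm_mult mult_left_le)
    show "summable (\<lambda>i. cmod (d i))"
      unfolding nd by (rule summable_mult[OF M])
  qed auto
  moreover have "d i * (if w i = 1 then 1 else 0) = (if l i = q then c i else 0)" for i
    using \<tau>[of i] by (auto simp: w_def d_def)
  ultimately show ?thesis
    unfolding eq by simp
qed

text \<open>
  Averaging \<open>f s * exp (q * s)\<close> along \<open>\<sigma> + \<i> j \<tau>\<close> extracts the coefficient of the frequency \<open>q\<close>,
  for all but countably many \<open>\<tau>\<close>. It can be computed from either representation of \<open>f\<close>, so
  frequencies outside \<open>L \<inter> L'\<close> have coefficient \<open>0\<close>.
\<close>
lemma gds_imp_dirichlet_represents:
  assumes "gds L \<sigma> N f" "gds L' \<sigma> N' f" "L \<inter> L' \<subseteq> range (\<lambda>n. ln (real (Suc n)))"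
  obtains b where "\<And>s. \<sigma> \<le> Re s \<Longrightarrow> dirichlet_term b s sums f s"
proof -
  obtain c l M where l: "\<And>i. l i \<in> L \<and> 0 \<le> l i" and M: "M \<le> N"
      "((\<lambda>i. cmod (c i) * exp (- \<sigma> * l i)) has_sum M) (UNIV::nat set)"
    and f: "\<And>s. \<sigma> \<le> Re s \<Longrightarrow> ((\<lambda>i. c i * exp (- s * of_real (l i))) has_sum f s) UNIV"
    using assms(1) unfolding gds_def by blast
  obtain d k M' where k: "\<And>i. k i \<in> L' \<and> 0 \<le> k i" and M': "M' \<le> N'"
      "((\<lambda>i. cmod (d i) * exp (- \<sigma> * k i)) has_sum M') (UNIV::nat set)"
    and g: "\<And>s. \<sigma> \<le> Re s \<Longrightarrow> ((\<lambda>i. d i * exp (- s * of_real (k i))) has_sum f s) UNIV"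
    using assms(2) unfolding gds_def by blast
  define K where "K = range l \<union> range k"
  \<comment> \<open>The bad \<tau> are those for which \<tau> (q - x) is a multiple of 2 pi for
    distinct frequencies x and q of the two representations. There are countably many, so a good
    \<tau> exists.\<close>
  have "countable ((\<lambda>(x, q, n). 2 * pi * of_int n / (q - x)) ` (K \<times> K \<times> (UNIV :: int set)))"
    unfolding K_def by (intro countable_image countable_SIGMA) auto
  then obtain \<tau> :: real where \<tau>: "\<tau> \<notin> (\<lambda>(x, q, n). 2 * pi * of_int n / (q - x)) ` (K \<times> K \<times> (UNIV :: int set))"
    using uncountable_UNIV_real by (metis UNIV_I countable_subset subsetI)
  have gen: "exp (\<i> * of_real (\<tau> * (q - x))) \<noteq> 1" if "x \<in> K" "q \<in> K" "x \<noteq> q" for x q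
  proof
    assume "exp (\<i> * of_real (\<tau> * (q - x))) = 1"
    then obtain n :: int where "\<tau> * (q - x) = of_int (2 * n) * pi"
      by (auto simp: exp_eq_1)
    then have "\<tau> = 2 * pi * of_int n / (q - x)"
      using that(3) by (simp add: field_simps)
    with \<tau> that show False by force
  qed
  \<comment> \<open>Frequencies may repeat, so the coefficient that matters is the sum over a fibre
    of \<open>l\<close>.\<close>
  define a where "a q = (\<Sum>\<^sub>\<infinity>i\<in>{i. l i = q}. c i)" for q
  have c_sum: "(c has_sum a q) {i. l i = q}" for q
  proof -
    have "(\<lambda>i. c i * exp (- of_real \<sigma> * of_real (l i))) summable_on {i. l i = q}"
      using summable_on_subset_banach[OF has_sum_imp_summable[OF f[of "of_real \<sigma>"]]] by simp
    then have "(\<lambda>i. c i * exp (- of_real \<sigma> * of_real q)) summable_on {i. l i = q}"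
      by (rule summable_on_cong[THEN iffD1, rotated]) auto
    then have "c summable_on {i. l i = q}"
      by (subst (asm) summable_on_cmult_left') auto
    then show ?thesis by (simp add: a_def)
  qed
  have a_eq_0: "a q = 0" if q: "q \<notin> range (\<lambda>n. ln (real (Suc n)))" for q
  proof (cases "q \<in> range l")
    case False
    then have "{i. l i = q} = {}" by auto
    then show ?thesis by (simp add: a_def)
  next
    case True
    then have "q \<in> K" by (simp add: K_def)
    have "q \<in> L" using True l by auto
    then have "q \<notin> L'" using q assms(3) by blast
    then have "q \<notin> range k" using k by auto
    \<comment> \<open>First the mean is computed from the second representation, in which
      \<open>q\<close> does not occur; further below the first one yields
      \<open>a q\<close>.\<close>
    have "(\<lambda>n. (\<Sum>j<n. f (Complex \<sigma> (real j * \<tau>)) * exp (Complex \<sigma> (real j * \<tau>) * of_real q)) / of_nat n)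
        \<longlonglongrightarrow> (\<Sum>i. if k i = q then d i else 0)"
      by (rule gds_mean_value[OF summable_on_imp_summable[OF has_sum_imp_summable[OF M'(2)]]
            has_sum_imp_sums[OF g] gen[OF _ \<open>q \<in> K\<close>]]) (auto simp: K_def)
    moreover have "(\<Sum>i. if k i = q then d i else 0) = 0"
    proof -
      have "(if k i = q then d i else 0) = 0" for i
        using \<open>q \<notin> range k\<close> by auto
      then show ?thesis by simp
    qed
    moreover have "(\<lambda>n. (\<Sum>j<n. f (Complex \<sigma> (real j * \<tau>)) * exp (Complex \<sigma> (real j * \<tau>) * of_real q)) / of_nat n)
        \<longlonglongrightarrow> (\<Sum>i. if l i = q then c i else 0)"
      by (rule gds_mean_value[OF summable_on_imp_summable[OF has_sum_imp_summable[OF M(2)]]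
            has_sum_imp_sums[OF f] gen[OF _ \<open>q \<in> K\<close>]]) (auto simp: K_def)
    moreover have "((\<lambda>i. if l i = q then c i else 0) has_sum a q) UNIV"
      using c_sum[of q] by (rule has_sum_cong_neutral[THEN iffD1, rotated -1]) auto
    then have "(\<Sum>i. if l i = q then c i else 0) = a q"
      by (rule sums_unique[OF has_sum_imp_sums, symmetric])
    ultimately show ?thesis
      by (simp add: LIMSEQ_unique)
  qed
  define b where "b n = a (ln (real n))" for n
  have "dirichlet_term b s sums f s" if s: "\<sigma> \<le> Re s" for s
  proof -
    let ?F = "\<lambda>i. c i * exp (- s * of_real (l i))"
    let ?S = "Sigma (range l) (\<lambda>q. {i. l i = q})"
    \<comment> \<open>Summation over the fibres of \<open>l\<close> merges equal
      frequencies.\<close>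
    have "bij_betw snd ?S UNIV"
      by (rule bij_betwI[of _ _ _ "\<lambda>i. (l i, i)"]) auto
    then have "((\<lambda>p. ?F (snd p)) has_sum f s) ?S"
      using f[OF s] by (subst has_sum_reindex_bij_betw)
    then have hs: "((\<lambda>q. a q * exp (- s * of_real q)) has_sum f s) (range l)"
    proof (rule has_sum_SigmaD)
      fix q
      have "((\<lambda>i. c i * exp (- s * of_real q)) has_sum a q * exp (- s * of_real q)) {i. l i = q}"
        by (rule has_sum_cmult_left[OF c_sum])
      then show "((\<lambda>i. ?F (snd (q, i))) has_sum a q * exp (- s * of_real q)) {i. l i = q}"
        by (rule has_sum_cong[THEN iffD1, rotated]) auto
    qed
    have a0: "a q = 0" if "q \<notin> range l" for q
    proof -
      have "{i. l i = q} = {}" using that by auto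
      then show ?thesis by (simp add: a_def)
    qed
    \<comment> \<open>Since \<open>a\<close> vanishes outside the range of \<open>l\<close> and also
      outside the logarithms of positive integers, one index set may be exchanged for the
      other.\<close>
    have "((\<lambda>q. a q * exp (- s * of_real q)) has_sum f s) (range (\<lambda>n. ln (real (Suc n))))"
      using hs by (rule has_sum_cong_neutral[THEN iffD1, rotated -1]) (use a_eq_0 a0 in auto)
    moreover have "inj (\<lambda>n. ln (real (Suc n)))"
      by (rule injI) simp
    ultimately have "((\<lambda>n. a (ln (real (Suc n))) * exp (- s * of_real (ln (real (Suc n))))) has_sum f s) UNIV"
      by (simp add: has_sum_reindex o_def)
    then show ?thesis
      unfolding dirichlet_term_eq b_def by (rule has_sum_imp_sums)
  qed
  then show thesis by (rule that)
qed

subsection \<open>Real powers with integer values\<close>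

primrec fwd_diff :: "nat \<Rightarrow> (real \<Rightarrow> real) \<Rightarrow> real \<Rightarrow> real" where
  "fwd_diff 0 f = f"
| "fwd_diff (Suc k) f = (\<lambda>x. fwd_diff k f (x + 1) - fwd_diff k f x)"

lemma fwd_diff_cmult: "fwd_diff k (\<lambda>x. c * f x) x = c * fwd_diff k f x"
  by (induction k arbitrary: x) (auto simp: algebra_simps)

lemma fwd_diff_Ints: "(\<And>i. f (x + real i) \<in> \<int>) \<Longrightarrow> fwd_diff k f x \<in> \<int>"
proof (induction k arbitrary: x)
  case 0
  from this[of 0] show ?case by simp
next
  case (Suc k)
  have "fwd_diff k f (x + 1) \<in> \<int>"
    by (rule Suc.IH) (use Suc.prems[of "Suc _"] in \<open>simp add: algebra_simps\<close>)
  moreover have "fwd_diff k f x \<in> \<int>"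
    by (rule Suc.IH) (rule Suc.prems)
  ultimately show ?case by simp
qed

lemma fwd_diff_has_derivative:
  assumes "\<And>y. 0 < y \<Longrightarrow> (f has_real_derivative f' y) (at y)" "0 < x"
  shows "(fwd_diff k f has_real_derivative fwd_diff k f' x) (at x)"
  using \<open>0 < x\<close>
proof (induction k arbitrary: x)
  case 0
  then show ?case using assms(1) by simp
next
  case (Suc k)
  have "((\<lambda>x. fwd_diff k f (x + 1)) has_real_derivative fwd_diff k f' (x + 1)) (at x)"
    using Suc.IH[of "x + 1"] Suc.prems by (simp add: DERIV_shift)
  from DERIV_diff[OF this Suc.IH[OF Suc.prems]] show ?case
    by simp
qed

text \<open>Differences commute with differentiation, so the mean value theorem, applied to the k-th
  difference, trades one further difference for a factor \<open>c\<close> and the exponent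
  \<open>c - 1\<close>. A lower bound for \<xi> suffices, since the power decreases once
  \<open>k > c\<close>.\<close>

lemma fwd_diff_powr:
  assumes "0 < x"
  shows "\<exists>\<xi>\<ge>x. fwd_diff k (\<lambda>x. x powr c) x = (\<Prod>i<k. c - real i) * \<xi> powr (c - real k)"
  using assms
proof (induction k arbitrary: c x)
  case 0
  then show ?case by auto
next
  case (Suc k)
  have D: "(fwd_diff k (\<lambda>x. x powr c) has_real_derivative fwd_diff k (\<lambda>x. c * x powr (c - 1)) y) (at y)"
    if "0 < y" for y
    by (rule fwd_diff_has_derivative) (use that in \<open>auto intro!: has_real_derivative_powr\<close>)
  have "\<exists>z. x < z \<and> z < x + 1 \<and> fwd_diff k (\<lambda>x. x powr c) (x + 1) - fwd_diff k (\<lambda>x. x powr c) x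
      = (x + 1 - x) * fwd_diff k (\<lambda>x. c * x powr (c - 1)) z"
    by (rule MVT2) (use Suc.prems in \<open>auto intro!: D\<close>)
  then obtain z where z: "x < z" "fwd_diff (Suc k) (\<lambda>x. x powr c) x = c * fwd_diff k (\<lambda>x. x powr (c - 1)) z"
    by (auto simp: fwd_diff_cmult)
  obtain \<xi> where \<xi>: "\<xi> \<ge> z" "fwd_diff k (\<lambda>x. x powr (c - 1)) z = (\<Prod>i<k. c - 1 - real i) * \<xi> powr (c - 1 - real k)"
    using Suc.IH[of z "c - 1"] z(1) Suc.prems by auto
  have "fwd_diff (Suc k) (\<lambda>x. x powr c) x = (\<Prod>i<Suc k. c - real i) * \<xi> powr (c - real (Suc k))"
    unfolding z(2) \<xi>(2) prod.lessThan_Suc_shift by (simp add: algebra_simps)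
  then show ?case using \<xi> z by (intro exI[of _ \<xi>]) auto
qed

text \<open>
  A high enough finite difference of \<open>n powr c\<close> is an integer and tends to \<open>0\<close>, hence vanishes,
  so one of the factors \<open>c - i\<close> does.
\<close>
lemma powr_Ints_imp_Nats:
  assumes "\<And>n::nat. 0 < n \<Longrightarrow> real n powr c \<in> \<int>"
  shows "c \<in> \<nat>"
proof -
  \<comment> \<open>With \<open>k > c\<close> the exponent \<open>c - k\<close> is negative, so the
    k-th difference tends to 0.\<close>
  define k where "k = Suc (nat \<lceil>c\<rceil>)"
  have "c < real k" unfolding k_def by linarith
  define P where "P = (\<Prod>i<k. c - real i)"
  have "((\<lambda>x. \<bar>P\<bar> * x powr (c - real k)) \<longlongrightarrow> \<bar>P\<bar> * 0) at_top"
    using \<open>c < real k\<close> by (intro tendsto_intros tendsto_neg_powr filterlim_ident) auto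
  then have "eventually (\<lambda>x. \<bar>P\<bar> * x powr (c - real k) < 1) at_top"
    by (rule order_tendstoD) simp
  then obtain X where X: "\<And>x. X \<le> x \<Longrightarrow> \<bar>P\<bar> * x powr (c - real k) < 1"
    by (auto simp: eventually_at_top_linorder)
  obtain n :: nat where n: "max X 1 \<le> real n"
    using real_arch_simple by blast
  then obtain \<xi> where \<xi>: "\<xi> \<ge> real n" "fwd_diff k (\<lambda>x. x powr c) (real n) = P * \<xi> powr (c - real k)"
    using fwd_diff_powr[of "real n" k c] unfolding P_def by auto
  have "fwd_diff k (\<lambda>x. x powr c) (real n) \<in> \<int>"
    using n assms[of "n + _"] by (intro fwd_diff_Ints) auto
  then have "P * \<xi> powr (c - real k) = 0"
    using X[of \<xi>] \<xi> n by (intro Ints_nonzero_abs_less1) (auto simp: abs_mult)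
  then obtain i where "c = real i"
    using \<xi> n by (auto simp: P_def)
  then show ?thesis by simp
qed

text \<open>Exponentiating gives 3^|a| = 2^|b|. The left side is odd, so b = 0, and then a =
  0.\<close>

lemma ln2_ln3_independent:
  fixes a b :: int
  assumes "of_int a / ln 2 = (of_int b / ln 3 :: real)"
  shows "a = 0 \<and> b = 0"
proof -
  have eq: "of_int a * ln 3 = (of_int b * ln 2 :: real)"
    using assms by (simp add: field_simps)
  then have "\<bar>of_int a * ln 3\<bar> = \<bar>of_int b * ln 2 :: real\<bar>"
    by (rule arg_cong)
  then have "real (nat \<bar>a\<bar>) * ln 3 = real (nat \<bar>b\<bar>) * ln 2"
    by (simp add: abs_mult)
  then have "ln (3 ^ nat \<bar>a\<bar>) = ln ((2::real) ^ nat \<bar>b\<bar>)"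
    by (simp add: ln_realpow)
  then have "(3::real) ^ nat \<bar>a\<bar> = 2 ^ nat \<bar>b\<bar>"
    by simp
  then have *: "(3::nat) ^ nat \<bar>a\<bar> = 2 ^ nat \<bar>b\<bar>"
    by (metis of_nat_eq_iff of_nat_numeral of_nat_power)
  have "odd ((3::nat) ^ nat \<bar>a\<bar>)" by simp
  then have "nat \<bar>b\<bar> = 0"
    unfolding * by simp
  then have "b = 0" by simp
  with eq show ?thesis by simp
qed

text \<open>A connected subset of a metric space with more than one point is uncountable.\<close>

lemma countable_range_imp_constant_on:
  fixes f :: "'a::topological_space \<Rightarrow> 'b::metric_space"
  assumes "connected S" "continuous_on S f" "countable (f ` S)" "x \<in> S" "y \<in> S"
  shows "f x = f y"
  using connected_uncountable[OF connected_continuous_image[OF assms(2,1)], of "f x" "f y"] assms by blast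

subsection \<open>Sufficiency\<close>

lemma gds_monomial: "l \<in> L \<Longrightarrow> 0 \<le> l \<Longrightarrow> 0 \<in> L \<Longrightarrow> gds L \<sigma> (exp (- \<sigma> * l)) (\<lambda>s. exp (- s * of_real l))"
  by (rule gdsI[of "{()}" _ "\<lambda>_. l" "\<lambda>_. 1"]) (auto intro!: has_sum_finiteI)

section \<open>The frequencies of ordinary Dirichlet series\<close>

definition log_nats :: "real set" where
  "log_nats = range (\<lambda>n. ln (real (Suc n)))"

lemma log_natsI: "0 < k \<Longrightarrow> ln (real k) \<in> log_nats"
  unfolding log_nats_def by (metis Suc_pred rangeI)

lemma zero_in_log_nats: "0 \<in> log_nats"
  using log_natsI[of 1] by simp

lemma add_in_log_nats: "x \<in> log_nats \<Longrightarrow> y \<in> log_nats \<Longrightarrow> x + y \<in> log_nats"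
proof -
  assume "x \<in> log_nats" "y \<in> log_nats"
  then obtain m n where "x = ln (real (Suc m))" "y = ln (real (Suc n))"
    unfolding log_nats_def by blast
  then have "x + y = ln (real (Suc m * Suc n))"
    by (simp only: of_nat_mult ln_mult_pos of_nat_0_less_iff zero_less_Suc)
  then show ?thesis
    using log_natsI[of "Suc m * Suc n"] by simp
qed

text \<open>
  If \<open>c k k\<^sup>-\<^sup>s\<close>, with \<open>k > 1\<close>, is the first non-constant term, then on a vertical line far to the
  right there are points at which it is a negative real number dominating the later terms.
\<close>
lemma Re_constant_term_gt:
  assumes c: "dirichlet_represents c (half_plane \<mu>) \<psi>" and half: "\<And>s. \<mu> < Re s \<Longrightarrow> r < Re (\<psi> s)"
  shows "r < Re (c 1)"
proof (cases "\<exists>k>1. c k \<noteq> 0")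
  case False
  define s where "s = complex_of_real (\<mu> + 1)"
  have "dirichlet_term c s sums \<psi> s"
    using c by (simp add: dirichlet_represents_def half_plane_def s_def)
  moreover have "dirichlet_term c s = (\<lambda>n. if n = 0 then c 1 else 0)"
    using False by (auto simp: dirichlet_term_def fun_eq_iff)
  ultimately have "\<psi> s = c 1"
    using sums_single[of 0 "\<lambda>_. c 1"] sums_unique2 by force
  then show ?thesis
    using half[of s] by (simp add: s_def)
next
  case True
  define m where "m = (LEAST k. 1 < k \<and> c k \<noteq> 0)"
  have m: "1 < m" "c m \<noteq> 0"
    using LeastI_ex[OF True[unfolded Bex_def]] by (auto simp: m_def)
  have least: "c k = 0" if "1 < k" "k < m" for k
    using that not_less_Least[of k "\<lambda>k. 1 < k \<and> c k \<noteq> 0"] by (auto simp: m_def)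
  \<comment> \<open>Without the constant term, \<open>m\<close> becomes the index of the leading
    term.\<close>
  define c' where "c' = c(1 := 0)"
  have "dirichlet_represents c' (half_plane \<mu>) (\<lambda>s. \<psi> s - c 1)"
    unfolding dirichlet_represents_def
  proof
    fix s assume "s \<in> half_plane \<mu>"
    then have "dirichlet_term c s sums \<psi> s"
      using c by (simp add: dirichlet_represents_def)
    from sums_diff[OF this sums_single[of 0 "\<lambda>_. c 1"]]
    show "dirichlet_term c' s sums (\<psi> s - c 1)"
      by (rule sums_cong[THEN iffD1, rotated]) (auto simp: c'_def dirichlet_term_def)
  qed
  then obtain \<sigma> u where \<sigma>: "\<mu> + 1 < \<sigma>" and u: "\<And>\<tau>. \<sigma> \<le> \<tau> \<Longrightarrow> gds {ln (real k / real m) |k. m < k} \<tau> (1/2) u"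
    "\<And>s. \<sigma> \<le> Re s \<Longrightarrow> \<psi> s - c 1 = c' m * exp (- s * of_real (ln (real m))) * (1 + u s)"
    by (rule dirichlet_leading_term[of c' _ _ m "1/2"]) (use m least in \<open>auto simp: c'_def\<close>)
  \<comment> \<open>At this height m^(-it) has argument - Arg (c m) - pi, so it turns
    \<open>c m\<close> onto the negative real axis.\<close>
  define t where "t = (Arg (c m) + pi) / ln (real m)"
  define s where "s = Complex \<sigma> t"
  have "- s * of_real (ln (real m)) = of_real (- \<sigma> * ln (real m)) - (\<i> * of_real (Arg (c m)) + \<i> * of_real pi)"
    using m by (auto simp: s_def t_def complex_eq_iff)
  then have e: "exp (- s * of_real (ln (real m)))
      = of_real (exp (- \<sigma> * ln (real m))) / (exp (\<i> * of_real (Arg (c m))) * exp (\<i> * of_real pi))"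
    by (simp only: exp_diff exp_add exp_of_real)
  have "c m = of_real (cmod (c m)) * exp (\<i> * of_real (Arg (c m)))"
    by (rule Arg_eq[OF m(2)])
  then have "c m * exp (- s * of_real (ln (real m))) = - of_real (cmod (c m) * exp (- \<sigma> * ln (real m)))"
    unfolding e by (simp add: field_simps)
  then have "Re (\<psi> s - c 1) = - (cmod (c m) * exp (- \<sigma> * ln (real m)) * Re (1 + u s))"
    using u(2)[of s] m by (simp add: s_def c'_def)
  \<comment> \<open>The bound 1/2 on \<open>u\<close> prevents the later terms from reversing the
    sign.\<close>
  moreover have "0 < Re (1 + u s)"
    using gds_norm_le[OF u(1)[OF order_refl], of s] abs_Re_le_cmod[of "u s"] by (simp add: s_def)
  then have "0 < cmod (c m) * exp (- \<sigma> * ln (real m)) * Re (1 + u s)"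
    using m by (intro mult_pos_pos) auto
  moreover have "r < Re (\<psi> s)"
    using half[of s] \<sigma> by (simp add: s_def)
  ultimately show ?thesis by simp
qed

text \<open>This is Cauchy-Schwarz in the form \<open>x * y \<le> x\<^sup>2 + y\<^sup>2\<close>,
  splitting the weight as n^(-\<delta>) n^(p + \<delta>).\<close>

lemma H_plus_abs_summable:
  assumes "a \<in> H_plus" "p < - 1 / 2"
  shows "summable (\<lambda>n. cmod (a (Suc n)) * real (Suc n) powr p)"
proof -
  \<comment> \<open>This choice gives 2 p + 2 \<delta> = p - 1/2 < -1, so the squares of the second
    factor are summable.\<close>
  define \<delta> where "\<delta> = (- 1 / 2 - p) / 2"
  have \<delta>: "0 < \<delta>" using assms by (simp add: \<delta>_def)
  have 1: "summable (\<lambda>n. (cmod (a (Suc n)))\<^sup>2 * real (Suc n) powr (- 2 * \<delta>))"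
    using assms(1) \<delta> by (simp add: H_plus_def)
  have "summable (\<lambda>n. real n powr (2 * p + 2 * \<delta>))"
    using assms(2) by (subst summable_real_powr_iff) (simp add: \<delta>_def field_simps)
  then have 2: "summable (\<lambda>n. real (Suc n) powr (2 * p + 2 * \<delta>))"
    by (subst summable_Suc_iff)
  show ?thesis
  proof (rule summable_comparison_test'[OF summable_add[OF 1 2], of 0])
    fix n
    define x where "x = cmod (a (Suc n)) * real (Suc n) powr (- \<delta>)"
    define y where "y = real (Suc n) powr (p + \<delta>)"
    have "x * y = cmod (a (Suc n)) * real (Suc n) powr p"
      by (simp add: x_def y_def powr_add[symmetric] mult.assoc)
    moreover have "x\<^sup>2 = (cmod (a (Suc n)))\<^sup>2 * real (Suc n) powr (- 2 * \<delta>)"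
      by (simp add: x_def power_mult_distrib power2_eq_square[of "_ powr _"] powr_add[symmetric])
    moreover have "y\<^sup>2 = real (Suc n) powr (2 * p + 2 * \<delta>)"
      by (simp add: y_def power2_eq_square powr_add[symmetric])
    moreover have "x * y \<le> x\<^sup>2 + y\<^sup>2"
    proof -
      have "0 \<le> x * y" by (simp add: x_def y_def)
      then show ?thesis using sum_squares_bound[of x y] by linarith
    qed
    ultimately show "norm (cmod (a (Suc n)) * real (Suc n) powr p)
        \<le> (cmod (a (Suc n)))\<^sup>2 * real (Suc n) powr (- 2 * \<delta>) + real (Suc n) powr (2 * p + 2 * \<delta>)"
      by simp
  qed
qed

lemma composition_operator_if_affine_plus_dirichlet:
  assumes maps: "\<phi> \<in> half_plane \<theta> \<rightarrow> half_plane (1/2)" and "\<theta> \<le> \<mu>"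
    and c: "dirichlet_represents c (half_plane \<mu>) \<psi>"
    and \<phi>: "\<And>s. s \<in> half_plane \<mu> \<Longrightarrow> \<phi> s = of_nat c0 * s + \<psi> s"
  shows "defines_composition_operator \<theta> \<phi>"
proof -
  define v where "v = (\<lambda>s. \<psi> s - c 1)"
  obtain N where "gds {ln (real k) |k. 1 < k} (\<mu> + 2) N (\<lambda>s. \<psi> s - (\<Sum>n<1. dirichlet_term c s n))"
    by (rule dirichlet_tail_gds[OF c, of "\<mu> + 2" 1]) auto
  then have N: "gds {ln (real k) |k. 1 < k} (\<mu> + 2) N v"
    by (simp add: v_def dirichlet_term_def)
  have far: "{ln (real k) |k. 1 < k} \<subseteq> {ln 2..}"
    by auto
  have small: "\<exists>\<sigma>1\<ge>\<mu> + 2. \<forall>\<tau>\<ge>\<sigma>1. gds {ln (real k) |k. 1 < k} \<tau> \<epsilon> v" if pos: "0 < \<epsilon>" for \<epsilon>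
  proof -
    obtain \<sigma>1 where "\<mu> + 2 \<le> \<sigma>1" "\<And>\<tau>. \<sigma>1 \<le> \<tau> \<Longrightarrow> gds {ln (real k) |k. 1 < k} \<tau> \<epsilon> v"
      by (rule gds_eventually_small[OF N far _ pos]) auto
    then show ?thesis by blast
  qed
  \<comment> \<open>The line \<sigma> and the bound \<epsilon> for \<open>v\<close> are chosen
    together, as both enter the exponent that governs the norm of n^(-\<phi>).\<close>
  obtain \<sigma> \<epsilon> where \<sigma>: "\<mu> + 2 \<le> \<sigma>" and v: "gds {ln (real k) |k. 1 < k} \<sigma> \<epsilon> v"
    and p: "\<epsilon> - real c0 * \<sigma> - Re (c 1) < - 1 / 2"
  proof (cases "c0 = 0")
    case True
    have "1/2 < Re (\<psi> s)" if "\<mu> < Re s" for s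
    proof -
      have "\<phi> s \<in> half_plane (1/2)"
        using maps that \<open>\<theta> \<le> \<mu>\<close> by (auto simp: half_plane_def)
      then show ?thesis
        using \<phi>[of s] that True by (simp add: half_plane_def)
    qed
    then have "1/2 < Re (c 1)"
      by (rule Re_constant_term_gt[OF c])
    \<comment> \<open>Half of the margin by which the real part of the constant term exceeds
      1/2.\<close>
    moreover define \<epsilon> where "\<epsilon> = (Re (c 1) - 1/2) / 2"
    ultimately have "0 < \<epsilon>" "\<epsilon> - Re (c 1) < - 1 / 2"
      by (simp_all add: field_simps)
    moreover obtain \<sigma> where "\<mu> + 2 \<le> \<sigma>" "gds {ln (real k) |k. 1 < k} \<sigma> \<epsilon> v"
      using small[OF \<open>0 < \<epsilon>\<close>] by blast
    ultimately show thesis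
      using True by (intro that[of \<sigma> \<epsilon>]) auto
  next
    case False
    obtain \<sigma>1 where \<sigma>1: "\<mu> + 2 \<le> \<sigma>1" "\<And>\<tau>. \<sigma>1 \<le> \<tau> \<Longrightarrow> gds {ln (real k) |k. 1 < k} \<tau> 1 v"
      using small[of 1] by auto
    \<comment> \<open>Since c0 >= 1 and \<sigma> >= 0, one has c0 \<sigma> >= \<sigma> >= 2 - Re (c
      1), which makes the exponent at most -1.\<close>
    define \<sigma> where "\<sigma> = max \<sigma>1 (max 0 (2 - Re (c 1)))"
    have "1 * \<sigma> \<le> real c0 * \<sigma>"
      using False by (intro mult_right_mono) (auto simp: \<sigma>_def)
    moreover have "2 - Re (c 1) \<le> \<sigma>"
      by (simp add: \<sigma>_def)
    ultimately show thesis
      using \<sigma>1 by (intro that[of \<sigma> 1]) (auto simp: \<sigma>_def)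
  qed
  define p where "p = \<epsilon> - real c0 * \<sigma> - Re (c 1)"
  have v: "gds log_nats \<sigma> \<epsilon> v"
    by (rule gds_mono[OF v]) (auto intro!: log_natsI)
  have "\<exists>b\<in>Dirichlet_space. \<exists>\<nu>\<ge>\<theta>. dirichlet_represents b (half_plane \<nu>) (dirichlet_sum a \<circ> \<phi>)"
    if a: "a \<in> H_plus" for a
  proof -
    define l where "l n = ln (real (Suc n))" for n
    define g where "g n s = a (Suc n) * (exp (- s * of_real (real c0 * l n)) *
        (exp (- c 1 * of_real (l n)) * exp (- of_real (l n) * v s)))" for n s
    have g: "gds log_nats \<sigma> (cmod (a (Suc n)) * real (Suc n) powr p) (g n)" for n
    proof -
      \<comment> \<open>Here it matters that c0 is a natural number: n^(-c0 s) is again an integer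
        to the power -s.\<close>
      have "real c0 * l n = ln (real (Suc n ^ c0))"
        by (simp only: l_def of_nat_power ln_realpow of_nat_0_less_iff zero_less_Suc)
      then have "real c0 * l n \<in> log_nats"
        using log_natsI[of "Suc n ^ c0"] by simp
      then have m: "gds log_nats \<sigma> (exp (- \<sigma> * (real c0 * l n))) (\<lambda>s. exp (- s * of_real (real c0 * l n)))"
        by (rule gds_monomial) (auto simp: l_def zero_in_log_nats)
      have e: "gds log_nats \<sigma> (exp (cmod (- of_real (l n)) * \<epsilon>)) (\<lambda>s. exp (- of_real (l n) * v s))"
        by (intro gds_exp gds_cmult v zero_in_log_nats add_in_log_nats)
      have "gds log_nats \<sigma> (cmod (a (Suc n)) * (exp (- \<sigma> * (real c0 * l n)) *
          (cmod (exp (- c 1 * of_real (l n))) * exp (cmod (- of_real (l n)) * \<epsilon>)))) (g n)"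
        unfolding g_def by (intro gds_cmult gds_mult[OF m] e zero_in_log_nats add_in_log_nats)
      moreover have "exp (- \<sigma> * (real c0 * l n)) * (cmod (exp (- c 1 * of_real (l n))) * exp (cmod (- of_real (l n)) * \<epsilon>))
          = real (Suc n) powr p"
        by (simp add: l_def powr_def p_def exp_add[symmetric] algebra_simps)
      ultimately show ?thesis by simp
    qed
    have S: "summable (\<lambda>n. cmod (a (Suc n)) * real (Suc n) powr p)"
      by (rule H_plus_abs_summable[OF a]) (use p in \<open>simp add: p_def\<close>)
    have eq: "(\<Sum>n. g n s) = (dirichlet_sum a \<circ> \<phi>) s" if "\<sigma> \<le> Re s" for s
    proof -
      have "\<phi> s = of_nat c0 * s + c 1 + v s"
        using \<phi>[of s] that \<sigma> by (simp add: half_plane_def v_def)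
      then have "g n s = dirichlet_term a (\<phi> s) n" for n
        by (simp add: g_def dirichlet_term_eq l_def exp_add[symmetric] algebra_simps)
      then show ?thesis by (simp add: dirichlet_sum_def)
    qed
    have "gds log_nats \<sigma> (\<Sum>n. cmod (a (Suc n)) * real (Suc n) powr p) (dirichlet_sum a \<circ> \<phi>)"
      by (rule gds_cong[OF gds_suminf[OF g S zero_in_log_nats] eq])
    \<comment> \<open>The same representation is used twice, so that the intersection of the
      frequency sets is \<open>log_nats\<close> itself.\<close>
    then obtain b where b: "\<And>s. \<sigma> \<le> Re s \<Longrightarrow> dirichlet_term b s sums (dirichlet_sum a \<circ> \<phi>) s"
      using gds_imp_dirichlet_represents by (metis inf.idem log_nats_def order_refl)
    have "b \<in> Dirichlet_space"
      using b[of "of_real \<sigma>"] by (auto simp: Dirichlet_space_def summable_def)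
    moreover have "dirichlet_represents b (half_plane \<sigma>) (dirichlet_sum a \<circ> \<phi>)"
      using b by (simp add: dirichlet_represents_def half_plane_def)
    ultimately show ?thesis
      using \<sigma> \<open>\<theta> \<le> \<mu>\<close> by (intro bexI[of _ b] exI[of _ \<sigma>]) auto
  qed
  then show ?thesis
    unfolding defines_composition_operator_def by blast
qed

subsection \<open>Necessity\<close>

text \<open>Division by a leading term n^(-c s) produces frequencies ln (k / n^c). Admitting every
  power of \<open>n\<close> in the denominator makes the set closed under addition, as the logarithm
  of 1 + u requires.\<close>

definition log_fractions :: "nat \<Rightarrow> real set" where
  "log_fractions n = {ln (real k / real (n ^ j)) |k j. 0 < k}"

lemma log_fractionsI: "0 < k \<Longrightarrow> ln (real k / real (n ^ j)) \<in> log_fractions n"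
  unfolding log_fractions_def by blast

lemma zero_in_log_fractions: "0 \<in> log_fractions n"
  using log_fractionsI[of 1 n 0] by simp

lemma add_in_log_fractions:
  assumes "0 < n" "x \<in> log_fractions n" "y \<in> log_fractions n"
  shows "x + y \<in> log_fractions n"
proof -
  obtain k j k' j' where k: "0 < k" "0 < k'" and x: "x = ln (real k / real (n ^ j))" and y: "y = ln (real k' / real (n ^ j'))"
    using assms unfolding log_fractions_def by blast
  have "x + y = ln (real k / real (n ^ j) * (real k' / real (n ^ j')))"
    unfolding x y using k assms(1) by (intro ln_mult_pos[symmetric]) auto
  also have "real k / real (n ^ j) * (real k' / real (n ^ j')) = real (k * k') / real (n ^ (j + j'))"
    by (simp add: power_add)
  finally show ?thesis
    using log_fractionsI[of "k * k'" n "j + j'"] k by simp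
qed

text \<open>A fraction that can be written both with a power of \<open>m\<close> and with a power of
  \<open>n\<close> as denominator is an integer: by coprimality m^j divides k.\<close>

lemma log_fractions_coprime:
  assumes "coprime m n" "0 < m" "0 < n"
  shows "log_fractions m \<inter> log_fractions n \<subseteq> log_nats"
proof
  fix x assume "x \<in> log_fractions m \<inter> log_fractions n"
  then obtain k j k' j' where k: "0 < k" "0 < k'" and x: "x = ln (real k / real (m ^ j))" "x = ln (real k' / real (n ^ j'))"
    unfolding log_fractions_def by blast
  then have "real k / real (m ^ j) = real k' / real (n ^ j')"
    using assms(2,3) by (subst (asm) x(1)) simp
  then have "real (k * n ^ j') = real (k' * m ^ j)"
    using assms(2,3) by (simp add: field_simps)
  then have eq: "k * n ^ j' = k' * m ^ j"
    by (simp only: of_nat_eq_iff)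
  have "m ^ j dvd k * n ^ j'"
    unfolding eq by simp
  moreover have "coprime (m ^ j) (n ^ j')"
    using assms(1) by simp
  ultimately have "m ^ j dvd k"
    by (simp add: coprime_dvd_mult_left_iff)
  then obtain q where q: "k = m ^ j * q"
    by (rule dvdE)
  with k assms(2) have "x = ln (real q)" "0 < q"
    by (auto simp: x(1))
  then show "x \<in> log_nats"
    using log_natsI by simp
qed

text \<open>The hypothesis is tested on the single monomial n^(-s), and the leading term of the
  resulting Dirichlet series is split off.\<close>

lemma composition_with_monomial:
  assumes "defines_composition_operator \<theta> \<phi>" "0 < n"
  obtains \<sigma> m z u where "\<theta> \<le> \<sigma>" "0 < m" "z \<noteq> 0"
    "\<And>\<tau>. \<sigma> \<le> \<tau> \<Longrightarrow> gds {ln (real k / real m) |k. m < k} \<tau> (1/2) u"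
    "\<And>s. \<sigma> \<le> Re s \<Longrightarrow> exp (- \<phi> s * of_real (ln (real n))) = z * exp (- s * of_real (ln (real m))) * (1 + u s)"
proof -
  define a :: "nat \<Rightarrow> complex" where "a k = (if k = n then 1 else 0)" for k
  have "a \<in> H_plus"
    unfolding H_plus_def
  proof (intro CollectI allI impI)
    show "summable (\<lambda>k. (cmod (a (Suc k)))\<^sup>2 * real (Suc k) powr (- 2 * \<sigma>))" for \<sigma>
      by (rule summable_finite[of "{n - 1}"]) (auto simp: a_def)
  qed
  then obtain b \<nu> where \<nu>: "\<theta> \<le> \<nu>" and b: "dirichlet_represents b (half_plane \<nu>) (dirichlet_sum a \<circ> \<phi>)"
    using assms(1) unfolding defines_composition_operator_def by blast
  have eq: "dirichlet_sum a s = exp (- s * of_real (ln (real n)))" for s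
    unfolding dirichlet_sum_def using \<open>0 < n\<close>
    by (subst suminf_finite[of "{n - 1}"]) (auto simp: a_def dirichlet_term_eq)
  \<comment> \<open>A leading term exists because the exponential has no zeros.\<close>
  have "\<exists>k. 0 < k \<and> b k \<noteq> 0"
  proof (rule ccontr)
    assume "\<not> ?thesis"
    then have "b (Suc n) = 0" for n by blast
    then have "dirichlet_term b s n = 0" for s n
      by (simp add: dirichlet_term_def)
    then have "dirichlet_term b (of_real (\<nu> + 1)) = (\<lambda>n. 0)"
      by blast
    moreover have "dirichlet_term b (of_real (\<nu> + 1)) sums (dirichlet_sum a \<circ> \<phi>) (of_real (\<nu> + 1))"
      using b unfolding dirichlet_represents_def half_plane_def by (elim bspec) simp
    ultimately have "(\<lambda>n. 0) sums (dirichlet_sum a \<circ> \<phi>) (of_real (\<nu> + 1))"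
      by simp
    then have "(dirichlet_sum a \<circ> \<phi>) (of_real (\<nu> + 1)) = 0"
      using sums_zero sums_unique2 by blast
    then show False by (simp add: eq)
  qed
  define m where "m = (LEAST k. 0 < k \<and> b k \<noteq> 0)"
  have m: "0 < m" "b m \<noteq> 0"
    using LeastI_ex[OF \<open>\<exists>k. 0 < k \<and> b k \<noteq> 0\<close>] by (auto simp: m_def)
  have "b k = 0" if "0 < k" "k < m" for k
    using that not_less_Least[of k "\<lambda>k. 0 < k \<and> b k \<noteq> 0"] by (auto simp: m_def)
  then obtain \<sigma> u where \<sigma>: "\<nu> + 1 < \<sigma>"
    and u: "\<And>\<tau>. \<sigma> \<le> \<tau> \<Longrightarrow> gds {ln (real k / real m) |k. m < k} \<tau> (1/2) u"
      "\<And>s. \<sigma> \<le> Re s \<Longrightarrow> (dirichlet_sum a \<circ> \<phi>) s = b m * exp (- s * of_real (ln (real m))) * (1 + u s)"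
    by (rule dirichlet_leading_term[OF b m, of "1/2"]) auto
  show thesis
    by (rule that[of \<sigma> m "b m" u]) (use \<sigma> \<nu> m u in \<open>auto simp: eq\<close>)
qed

text \<open>Take moduli and logarithms at real x. Since |1 + u| lies between 1/2 and 2, its
  logarithm is at most ln 2 in absolute value, and division by x leaves an error of at most K /
  x.\<close>

lemma Re_symbol_asymptotics:
  assumes eq: "\<And>s. \<sigma> \<le> Re s \<Longrightarrow> exp (- \<phi> s * of_real (ln (real n))) = z * exp (- s * of_real (ln (real m))) * (1 + u s)"
    and u: "gds L \<sigma> (1/2) u" and "z \<noteq> 0" "1 < n"
  shows "((\<lambda>x. Re (\<phi> (of_real x)) / x) \<longlongrightarrow> ln (real m) / ln (real n)) at_top"
proof -
  define K where "K = (\<bar>ln (cmod z)\<bar> + ln 2) / ln (real n)"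
  have "0 < ln (real n)" using \<open>1 < n\<close> by simp
  have "((\<lambda>x. Re (\<phi> (of_real x)) / x - ln (real m) / ln (real n)) \<longlongrightarrow> 0) at_top"
  proof (rule Lim_null_comparison)
    show "((\<lambda>x. K / x) \<longlongrightarrow> 0) at_top"
      by real_asymp
    show "eventually (\<lambda>x. norm (Re (\<phi> (of_real x)) / x - ln (real m) / ln (real n)) \<le> K / x) at_top"
      using eventually_ge_at_top[of \<sigma>] eventually_gt_at_top[of 0]
    proof eventually_elim
      case (elim x)
      define w where "w = cmod (1 + u (of_real x))"
      have "cmod (u (of_real x)) \<le> 1/2"
        by (rule gds_norm_le[OF u]) (use elim in simp)
      then have w: "1/2 \<le> w" "w \<le> 2"
        using norm_triangle_ineq[of 1 "u (of_real x)"] norm_triangle_ineq2[of 1 "- u (of_real x)"]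
        by (auto simp: w_def)
      have "\<bar>ln w\<bar> \<le> ln 2"
        using w ln_mono[of w 2] ln_mono[of "1/2" w] by (auto simp: ln_div abs_le_iff)
      have "exp (- Re (\<phi> (of_real x)) * ln (real n)) = cmod z * exp (- x * ln (real m)) * w"
        using arg_cong[OF eq[of "of_real x"], of cmod] elim by (simp add: norm_mult w_def)
      then have "- Re (\<phi> (of_real x)) * ln (real n) = ln (cmod z * exp (- x * ln (real m)) * w)"
        by (metis ln_exp)
      also have "\<dots> = ln (cmod z) + - x * ln (real m) + ln w"
        using \<open>z \<noteq> 0\<close> w by (simp add: ln_mult_pos)
      finally have "Re (\<phi> (of_real x)) / x - ln (real m) / ln (real n) = - (ln (cmod z) + ln w) / ln (real n) / x"
        using \<open>0 < ln (real n)\<close> elim by (simp add: field_simps)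
      moreover have "\<bar>- (ln (cmod z) + ln w) / ln (real n)\<bar> \<le> K"
        unfolding K_def using \<open>\<bar>ln w\<bar> \<le> ln 2\<close> \<open>0 < ln (real n)\<close>
        by (auto simp: abs_divide intro!: divide_right_mono)
      then have "\<bar>- (ln (cmod z) + ln w) / ln (real n)\<bar> / x \<le> K / x"
        using elim by (intro divide_right_mono) auto
      ultimately show ?case
        using elim by (simp only: real_norm_def abs_divide[of _ x] abs_of_pos)
    qed
  qed
  then show ?thesis
    by (rule LIM_zero_cancel)
qed

text \<open>The identity ln (n^c) = c ln n produces the linear term, and Ln (1 + u) stays in the
  algebra because \<open>u\<close> has norm at most 1/2. The logarithm is taken separately at each
  point, so nothing is known yet about how \<open>k\<close> depends on \<open>s\<close>.\<close>

lemma symbol_branch: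
  assumes eq: "\<And>s. \<sigma> \<le> Re s \<Longrightarrow> exp (- \<phi> s * of_real (ln (real n))) = z * exp (- s * of_real (ln (real (n ^ c)))) * (1 + u s)"
    and u: "gds {ln (real k / real (n ^ c)) |k. n ^ c < k} \<sigma> (1/2) u" and "z \<noteq> 0" "1 < n"
  shows "\<exists>P N k. gds (log_fractions n) \<sigma> N P \<and>
    (\<forall>s. \<sigma> \<le> Re s \<longrightarrow> \<phi> s - of_nat c * s = P s - 2 * of_real pi * \<i> * of_int (k s) / of_real (ln (real n)))"
proof -
  define lam where "lam = complex_of_real (ln (real n))"
  have lam: "lam \<noteq> 0" using \<open>1 < n\<close> by (simp add: lam_def)
  define P where "P = (\<lambda>s. - Ln z / lam + - (1 / lam) * Ln (1 + u s))"
  have add: "x \<in> log_fractions n \<Longrightarrow> y \<in> log_fractions n \<Longrightarrow> x + y \<in> log_fractions n" for x y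
    using add_in_log_fractions \<open>1 < n\<close> by simp
  have "gds (log_fractions n) \<sigma> (1/2) u"
    by (rule gds_mono[OF u]) (use log_fractionsI[of _ n c] in auto)
  then have "gds (log_fractions n) \<sigma> 1 (\<lambda>s. Ln (1 + u s))"
    by (rule gds_ln_one_plus) (auto intro: add zero_in_log_fractions)
  then have P: "gds (log_fractions n) \<sigma> (cmod (- Ln z / lam) + cmod (- (1 / lam)) * 1) P"
    unfolding P_def by (intro gds_add gds_const gds_cmult zero_in_log_fractions add) auto
  have "\<exists>k::int. \<phi> s - of_nat c * s = P s - 2 * of_real pi * \<i> * of_int k / lam" if s: "\<sigma> \<le> Re s" for s
  proof -
    have "1 + u s \<noteq> 0"
    proof
      assume "1 + u s = 0"
      then have "u s = - 1"
        by (metis add.inverse_inverse neg_eq_iff_add_eq_0)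
      then show False using gds_norm_le[OF u s] by simp
    qed
    have "of_real (ln (real (n ^ c))) = of_nat c * lam"
      using \<open>1 < n\<close> by (simp add: lam_def ln_realpow)
    then have "exp (- \<phi> s * lam) = exp (Ln z) * exp (- s * (of_nat c * lam)) * exp (Ln (1 + u s))"
      using eq[OF s] \<open>z \<noteq> 0\<close> \<open>1 + u s \<noteq> 0\<close> by (simp add: lam_def)
    also have "\<dots> = exp (Ln z - s * (of_nat c * lam) + Ln (1 + u s))"
      by (simp add: exp_add exp_diff exp_minus field_simps)
    finally obtain k :: int where "- \<phi> s * lam = Ln z - s * (of_nat c * lam) + Ln (1 + u s) + of_real (of_int (2 * k) * pi) * \<i>"
      unfolding exp_eq by blast
    then have "\<phi> s - of_nat c * s = P s - 2 * of_real pi * \<i> * of_int k / lam"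
      using lam by (simp add: P_def field_simps)
    then show ?thesis by blast
  qed
  then obtain k :: "complex \<Rightarrow> int" where "\<And>s. \<sigma> \<le> Re s \<Longrightarrow> \<phi> s - of_nat c * s = P s - 2 * of_real pi * \<i> * of_int (k s) / lam"
    by metis
  with P show ?thesis
    unfolding lam_def by (intro exI[of _ P] exI[of _ k]) auto
qed

text \<open>The exponent \<open>c\<close> is common to all \<open>n\<close>, since Re \<phi>(x) / x
  has only one limit. The conclusion covers every factorisation of this shape, so that it applies to
  whichever one is obtained later.\<close>

lemma symbol_exponent_is_nat:
  assumes "defines_composition_operator \<theta> \<phi>"
  obtains c :: nat where "\<And>n m \<sigma> z u L. 1 < n \<Longrightarrow> 0 < m \<Longrightarrow> z \<noteq> 0 \<Longrightarrow> gds L \<sigma> (1/2) u \<Longrightarrow>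
    (\<And>s. \<sigma> \<le> Re s \<Longrightarrow> exp (- \<phi> s * of_real (ln (real n))) = z * exp (- s * of_real (ln (real m))) * (1 + u s))
    \<Longrightarrow> m = n ^ c"
proof -
  define Q where "Q n m \<longleftrightarrow> (\<exists>z u \<sigma> L. z \<noteq> 0 \<and> gds L \<sigma> (1/2) u \<and>
    (\<forall>s. \<sigma> \<le> Re s \<longrightarrow> exp (- \<phi> s * of_real (ln (real n))) = z * exp (- s * of_real (ln (real m))) * (1 + u s)))"
    for n m :: nat
  have lim: "((\<lambda>x. Re (\<phi> (of_real x)) / x) \<longlongrightarrow> ln (real m) / ln (real n)) at_top" if "Q n m" "1 < n" for n m
  proof -
    obtain z u \<sigma> L where *: "z \<noteq> 0" "gds L \<sigma> (1/2) u"
        "\<And>s. \<sigma> \<le> Re s \<Longrightarrow> exp (- \<phi> s * of_real (ln (real n))) = z * exp (- s * of_real (ln (real m))) * (1 + u s)"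
      using \<open>Q n m\<close> unfolding Q_def by blast
    show ?thesis by (rule Re_symbol_asymptotics[OF *(3,2,1) that(2)])
  qed
  have ex: "\<exists>m>0. Q n m" if n: "0 < n" for n
  proof -
    obtain \<sigma> m z u where *: "0 < m" "z \<noteq> 0"
        "\<And>\<tau>. \<sigma> \<le> \<tau> \<Longrightarrow> gds {ln (real k / real m) |k. m < k} \<tau> (1/2) u"
        "\<And>s. \<sigma> \<le> Re s \<Longrightarrow> exp (- \<phi> s * of_real (ln (real n))) = z * exp (- s * of_real (ln (real m))) * (1 + u s)"
      by (rule composition_with_monomial[OF assms n]) blast
    have "Q n m"
      unfolding Q_def
      by (rule exI[of _ z], rule exI[of _ u], rule exI[of _ \<sigma>], rule exI) (use *(2,4) *(3)[OF order_refl] in auto)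
    with *(1) show ?thesis by blast
  qed
  obtain m2 where "Q 2 m2" using ex[of 2] by auto
  define d where "d = ln (real m2) / ln 2"
  \<comment> \<open>Both quotients are limits of the same function.\<close>
  have d: "ln (real m) / ln (real n) = d" if "Q n m" "1 < n" for n m
    using tendsto_unique[OF _ lim[OF that] lim[OF \<open>Q 2 m2\<close>]] by (simp add: d_def)
  have powr: "real n powr d = real m" if "Q n m" "1 < n" "0 < m" for n m
  proof -
    have "d * ln (real n) = ln (real m)"
      using d[OF that(1,2)] that(2) by (simp add: field_simps)
    then show ?thesis using that by (simp add: powr_def)
  qed
  have "real n powr d \<in> \<int>" if n: "0 < n" for n
  proof (cases "n = 1")
    case False
    with n have "1 < n" by simp
    obtain m where "0 < m" "Q n m" using ex[OF n] by blast
    then show ?thesis using powr[OF _ \<open>1 < n\<close>] by simp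
  qed simp
  then have "d \<in> \<nat>" by (rule powr_Ints_imp_Nats)
  then obtain c where c: "d = real c" by (auto elim: Nats_cases)
  show thesis
  proof (rule that[of c])
    fix n m :: nat and \<sigma> z u L
    assume *: "1 < n" "0 < m" "z \<noteq> 0" "gds L \<sigma> (1/2) u"
      "\<And>s. \<sigma> \<le> Re s \<Longrightarrow> exp (- \<phi> s * of_real (ln (real n))) = z * exp (- s * of_real (ln (real m))) * (1 + u s)"
    have "Q n m"
      unfolding Q_def
      by (rule exI[of _ z], rule exI[of _ u], rule exI[of _ \<sigma>], rule exI[of _ L]) (use * in auto)
    then have "real n powr real c = real m" using powr * c by simp
    then have "real (n ^ c) = real m" using * by (simp add: powr_realpow)
    then show "m = n ^ c" by (simp only: of_nat_eq_iff)
  qed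
qed

lemma affine_plus_dirichlet_if_composition_operator:
  assumes "defines_composition_operator \<theta> \<phi>"
  obtains \<mu> c and c0 :: nat where "\<theta> \<le> \<mu>" "\<phi> holomorphic_on half_plane \<mu>" "c \<in> Dirichlet_space"
    "dirichlet_represents c (half_plane \<mu>) (\<lambda>s. \<phi> s - of_nat c0 * s)"
proof -
  obtain c0 :: nat where c0: "\<And>n m \<sigma> z u L. 1 < n \<Longrightarrow> 0 < m \<Longrightarrow> z \<noteq> 0 \<Longrightarrow> gds L \<sigma> (1/2) u \<Longrightarrow>
    (\<And>s. \<sigma> \<le> Re s \<Longrightarrow> exp (- \<phi> s * of_real (ln (real n))) = z * exp (- s * of_real (ln (real m))) * (1 + u s))
    \<Longrightarrow> m = n ^ c0"
    using symbol_exponent_is_nat[OF assms] by blast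
  have branch: "\<exists>\<sigma> P k. \<theta> \<le> \<sigma> \<and> (\<forall>\<tau>\<ge>\<sigma>. \<exists>N. gds (log_fractions n) \<tau> N P) \<and> (\<forall>s. \<sigma> \<le> Re s \<longrightarrow>
      \<phi> s - of_nat c0 * s = P s - 2 * of_real pi * \<i> * of_int (k s) / of_real (ln (real n)))"
    if n: "1 < n" for n
  proof -
    obtain \<sigma> m z u where \<sigma>: "\<theta> \<le> \<sigma>" and m: "0 < m" and z: "z \<noteq> 0"
      and u: "\<And>\<tau>. \<sigma> \<le> \<tau> \<Longrightarrow> gds {ln (real k / real m) |k. m < k} \<tau> (1/2) u"
      and eq: "\<And>s. \<sigma> \<le> Re s \<Longrightarrow> exp (- \<phi> s * of_real (ln (real n))) = z * exp (- s * of_real (ln (real m))) * (1 + u s)"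
      by (rule composition_with_monomial[OF assms, of n]) (use n in \<open>simp, blast\<close>)
    have mc: "m = n ^ c0"
      by (rule c0[OF n m z u[OF order_refl] eq])
    obtain P N k where P: "gds (log_fractions n) \<sigma> N P"
      "\<And>s. \<sigma> \<le> Re s \<Longrightarrow> \<phi> s - of_nat c0 * s = P s - 2 * of_real pi * \<i> * of_int (k s) / of_real (ln (real n))"
      using symbol_branch[OF eq[unfolded mc] u[OF order_refl, unfolded mc] z n] by blast
    \<comment> \<open>All lines further right are kept, so that the cases n = 2 and n = 3 can be
      compared on a common half-plane.\<close>
    have "\<forall>\<tau>\<ge>\<sigma>. \<exists>N. gds (log_fractions n) \<tau> N P"
      using gds_mono[OF P(1) order_refl _ order_refl] by blast
    then show ?thesis
      by (intro exI[of _ \<sigma>] exI[of _ P] exI[of _ k]) (use \<sigma> P(2) in auto)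
  qed
  obtain \<sigma>2 P2 k2 where 2: "\<theta> \<le> \<sigma>2" "\<And>\<tau>. \<sigma>2 \<le> \<tau> \<Longrightarrow> \<exists>N. gds (log_fractions 2) \<tau> N P2"
    "\<And>s. \<sigma>2 \<le> Re s \<Longrightarrow> \<phi> s - of_nat c0 * s = P2 s - 2 * of_real pi * \<i> * of_int (k2 s) / of_real (ln 2)"
    using branch[of 2] by auto
  obtain \<sigma>3 P3 k3 where 3: "\<theta> \<le> \<sigma>3" "\<And>\<tau>. \<sigma>3 \<le> \<tau> \<Longrightarrow> \<exists>N. gds (log_fractions 3) \<tau> N P3"
    "\<And>s. \<sigma>3 \<le> Re s \<Longrightarrow> \<phi> s - of_nat c0 * s = P3 s - 2 * of_real pi * \<i> * of_int (k3 s) / of_real (ln 3)"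
    using branch[of 3] by auto
  define \<sigma> where "\<sigma> = max \<sigma>2 \<sigma>3"
  define H where "H = {s. \<sigma> < Re s}"
  obtain N2 where N2: "gds (log_fractions 2) \<sigma> N2 P2"
    using 2(2)[of \<sigma>] by (auto simp: \<sigma>_def)
  obtain N3 where N3: "gds (log_fractions 3) \<sigma> N3 P3"
    using 3(2)[of \<sigma>] by (auto simp: \<sigma>_def)
  have diff: "P2 s - P3 s = 2 * of_real pi * \<i> * (of_int (k2 s) / of_real (ln 2) - of_int (k3 s) / of_real (ln 3))"
    if "s \<in> H" for s
  proof -
    have "P2 s - 2 * of_real pi * \<i> * of_int (k2 s) / of_real (ln 2)
        = P3 s - 2 * of_real pi * \<i> * of_int (k3 s) / of_real (ln 3)"
      using 2(3)[of s] 3(3)[of s] that by (simp add: H_def \<sigma>_def)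
    then have "P2 s - P3 s = 2 * of_real pi * \<i> * of_int (k2 s) / of_real (ln 2)
        - 2 * of_real pi * \<i> * of_int (k3 s) / of_real (ln 3)"
      by (simp only: diff_eq_eq eq_diff_eq add.commute add.assoc diff_add_eq diff_diff_eq2 add_diff_eq)
    then show ?thesis
      by (simp add: right_diff_distrib)
  qed
  \<comment> \<open>Although \<open>k2\<close> and \<open>k3\<close> need not be continuous,
    \<open>P2 - P3\<close> is, and it takes values in a set indexed by pairs of integers.\<close>
  have const: "P2 s - P3 s = P2 t - P3 t" if "s \<in> H" "t \<in> H" for s t
  proof (rule countable_range_imp_constant_on[of H "\<lambda>s. P2 s - P3 s"])
    show "connected H"
      unfolding H_def by (intro convex_connected convex_halfspace_Re_gt)
    show "continuous_on H (\<lambda>s. P2 s - P3 s)"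
      using gds_holomorphic[OF N2] gds_holomorphic[OF N3] unfolding H_def
      by (intro continuous_on_diff holomorphic_on_imp_continuous_on)
    have "(\<lambda>s. P2 s - P3 s) ` H \<subseteq>
        (\<lambda>(j, k). 2 * of_real pi * \<i> * (of_int j / of_real (ln 2) - of_int k / of_real (ln 3))) ` (UNIV :: (int \<times> int) set)"
      using diff by (auto simp: image_iff)
    then show "countable ((\<lambda>s. P2 s - P3 s) ` H)"
      by (rule countable_subset) auto
  qed (use that in auto)
  define s0 where "s0 = complex_of_real (\<sigma> + 1)"
  have s0: "s0 \<in> H" by (simp add: s0_def H_def)
  \<comment> \<open>A constant difference fixes both integers at once, by the independence of 1 / ln
    2 and 1 / ln 3 over the integers.\<close>
  have k: "k2 s = k2 s0 \<and> k3 s = k3 s0" if "s \<in> H" for s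
  proof -
    have "of_int (k2 s) / of_real (ln 2) - of_int (k3 s) / of_real (ln 3)
        = (of_int (k2 s0) / of_real (ln 2) - of_int (k3 s0) / of_real (ln 3) :: complex)"
      using const[OF that s0] unfolding diff[OF that] diff[OF s0] by simp
    then have "complex_of_real (of_int (k2 s - k2 s0) / ln 2) = complex_of_real (of_int (k3 s - k3 s0) / ln 3)"
      by (simp add: diff_divide_distrib algebra_simps)
    then have "of_int (k2 s - k2 s0) / ln 2 = (of_int (k3 s - k3 s0) / ln 3 :: real)"
      by (simp only: of_real_eq_iff)
    from ln2_ln3_independent[OF this] show ?thesis by simp
  qed
  \<comment> \<open>The integers are constant on the open half-plane \<open>H\<close>, while
    \<open>gds\<close> concerns a closed one; the shift by 1 places the latter inside
    \<open>H\<close>.\<close>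
  define \<mu> where "\<mu> = \<sigma> + 1"
  define \<psi> where "\<psi> = (\<lambda>s. \<phi> s - of_nat c0 * s)"
  have g2: "\<exists>N. gds (log_fractions 2) \<mu> N \<psi>"
  proof -
    have "gds (log_fractions 2) \<mu> (N2 + cmod (- 2 * of_real pi * \<i> * of_int (k2 s0) / of_real (ln 2)))
        (\<lambda>s. P2 s + (- 2 * of_real pi * \<i> * of_int (k2 s0) / of_real (ln 2)))"
      by (intro gds_add gds_const zero_in_log_fractions gds_mono[OF N2]) (auto simp: \<mu>_def)
    moreover have "P2 s + (- 2 * of_real pi * \<i> * of_int (k2 s0) / of_real (ln 2)) = \<psi> s" if "\<mu> \<le> Re s" for s
    proof -
      have "s \<in> H" using that by (simp add: H_def \<mu>_def)
      then have "k2 s = k2 s0" "\<sigma>2 \<le> Re s"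
        using k[of s] by (simp_all add: H_def \<sigma>_def)
      then show ?thesis using 2(3)[of s] by (simp add: \<psi>_def)
    qed
    ultimately show ?thesis
      by (intro exI) (rule gds_cong)
  qed
  have g3: "\<exists>N. gds (log_fractions 3) \<mu> N \<psi>"
  proof -
    have "gds (log_fractions 3) \<mu> (N3 + cmod (- 2 * of_real pi * \<i> * of_int (k3 s0) / of_real (ln 3)))
        (\<lambda>s. P3 s + (- 2 * of_real pi * \<i> * of_int (k3 s0) / of_real (ln 3)))"
      by (intro gds_add gds_const zero_in_log_fractions gds_mono[OF N3]) (auto simp: \<mu>_def)
    moreover have "P3 s + (- 2 * of_real pi * \<i> * of_int (k3 s0) / of_real (ln 3)) = \<psi> s" if "\<mu> \<le> Re s" for s
    proof -
      have "s \<in> H" using that by (simp add: H_def \<mu>_def)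
      then have "k3 s = k3 s0" "\<sigma>3 \<le> Re s"
        using k[of s] by (simp_all add: H_def \<sigma>_def)
      then show ?thesis using 3(3)[of s] by (simp add: \<psi>_def)
    qed
    ultimately show ?thesis
      by (intro exI) (rule gds_cong)
  qed
  \<comment> \<open>The constant integers were absorbed at frequency 0, so \<psi> itself has both
    representations, and coprimality leaves only logarithms of integers.\<close>
  have "coprime (2::nat) 3" by simp
  then have "log_fractions 2 \<inter> log_fractions 3 \<subseteq> log_nats"
    by (rule log_fractions_coprime) auto
  then obtain c where c: "\<And>s. \<mu> \<le> Re s \<Longrightarrow> dirichlet_term c s sums \<psi> s"
    using g2 g3 gds_imp_dirichlet_represents unfolding log_nats_def by blast
  show thesis
  proof (rule that)
    show "\<theta> \<le> \<mu>"
      using 2(1) by (simp add: \<mu>_def \<sigma>_def)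
    show "c \<in> Dirichlet_space"
      using c[of "of_real \<mu>"] by (auto simp: Dirichlet_space_def summable_def)
    show "dirichlet_represents c (half_plane \<mu>) (\<lambda>s. \<phi> s - of_nat c0 * s)"
      using c by (auto simp: dirichlet_represents_def half_plane_def \<psi>_def)
    \<comment> \<open>Analyticity of \<phi> is thus a consequence: it is inherited from the series
      for \<psi>.\<close>
    have "\<psi> holomorphic_on half_plane \<mu>"
      using g2 gds_holomorphic unfolding half_plane_def by blast
    then have "(\<lambda>s. of_nat c0 * s + \<psi> s) holomorphic_on half_plane \<mu>"
      by (intro holomorphic_intros)
    then show "\<phi> holomorphic_on half_plane \<mu>"
      by (simp add: \<psi>_def)
  qed
qed

theorem theorem4p1:
  fixes \<theta> :: real and \<phi> :: "complex \<Rightarrow> complex"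
  assumes "\<phi> \<in> half_plane \<theta> \<rightarrow> half_plane (1/2)"
  shows "defines_composition_operator \<theta> \<phi> \<longleftrightarrow>
    (\<exists>\<mu>\<ge>\<theta>. \<phi> analytic_on half_plane \<mu> \<and>
       (\<exists>(c\<^sub>0::nat) (\<psi>::complex \<Rightarrow> complex). \<exists>c\<in>Dirichlet_space.
          dirichlet_represents c (half_plane \<mu>) \<psi> \<and>
          (\<forall>s\<in>half_plane \<mu>. \<phi> s = of_nat c\<^sub>0 * s + \<psi> s)))"
proof
  assume "defines_composition_operator \<theta> \<phi>"
  then obtain \<mu> c and c0 :: nat where *: "\<theta> \<le> \<mu>" "\<phi> holomorphic_on half_plane \<mu>" "c \<in> Dirichlet_space"
    "dirichlet_represents c (half_plane \<mu>) (\<lambda>s. \<phi> s - of_nat c0 * s)"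
    by (rule affine_plus_dirichlet_if_composition_operator)
  have "open (half_plane \<mu>)"
    by (simp add: half_plane_def open_halfspace_Re_gt)
  with * show "\<exists>\<mu>\<ge>\<theta>. \<phi> analytic_on half_plane \<mu> \<and>
       (\<exists>(c\<^sub>0::nat) (\<psi>::complex \<Rightarrow> complex). \<exists>c\<in>Dirichlet_space.
          dirichlet_represents c (half_plane \<mu>) \<psi> \<and>
          (\<forall>s\<in>half_plane \<mu>. \<phi> s = of_nat c\<^sub>0 * s + \<psi> s))"
    by (intro exI[of _ \<mu>] conjI exI[of _ c0] exI[of _ "\<lambda>s. \<phi> s - of_nat c0 * s"] bexI[of _ c])
      (auto simp: analytic_on_open)
next
  assume "\<exists>\<mu>\<ge>\<theta>. \<phi> analytic_on half_plane \<mu> \<and>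
       (\<exists>(c\<^sub>0::nat) (\<psi>::complex \<Rightarrow> complex). \<exists>c\<in>Dirichlet_space.
          dirichlet_represents c (half_plane \<mu>) \<psi> \<and>
          (\<forall>s\<in>half_plane \<mu>. \<phi> s = of_nat c\<^sub>0 * s + \<psi> s))"
  then show "defines_composition_operator \<theta> \<phi>"
    using composition_operator_if_affine_plus_dirichlet[OF assms] by blast
qed

end
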